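(* Let $n\ge1$, let $V$ be a complex vector space with $\dim V=2n$, and let $\rho$ be the representation of $\mathfrak{gl}(2n)=\mathfrak{gl}(V)$ on the space of skew-symmetric forms $\Lambda^2(V)$ corresponding to the congruence action. Then the Jordan--Kronecker invariants of $\rho$ are: - $n(2n+1)$ horizontal indices: $1$ taken $3n$ times and $2$ taken $2n(n-1)$ times; - $n$ Jordan $1\times1$ blocks with distinct eigenvalues (and there are no other blocks).
   Context: Everything is over $\mathbb{C}$ and finite-dimensional. Pencils. For linear maps $A,B:U\to V$ there are bases of $U$ and $V$ (Kronecker's theorem) in which all matrices $A+\lambda B$ are simultaneously block-diagonal, each pair of diagonal blocks $(A_i,B_i)$ being one of: (i) a $k\times k$ Jordan block with eigenvalue $\lambda_0\in\mathbb{C}$: $A_i=J_k(\lambda_0)$ (the upper triangular Jordan block), $B_i=I_k$; (ii) a $k\times k$ Jordan block with eigenvalue $\infty$: $A_i=I_k$, $B_i=J_k(0)$; (iii) a horizontal Kronecker block of size $(h-1)\times h$, $h\ge 1$: $A_i=(0\,|\,I_{h-1})$, $B_i=(I_{h-1}\,|\,0)$; (iv) a vertical Kronecker block of size $v\times(v-1)$, $v\ge1$: the transposes of the matrices in (iii) with $h=v$. A $0\times 1$ horizontal block ($h=1$) is a zero column and a $1\times 0$ vertical block ($v=1$) is a zero row. The blocks are unique up to permutation. The numbers $h$ (widths of horizontal blocks) are the horizontal indices, the numbers $v$ (heights of vertical blocks) are the vertical indices. Representations. For a representation $\rho:\mathfrak{g}\to\mathfrak{gl}(W)$ and $x\in W$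 put $R_x:\mathfrak{g}\to W$, $R_x(\xi)=\rho(\xi)x$. The algebraic type of the pencil $R_a+\lambda R_b=R_{a+\lambda b}$ is the collection: number of distinct eigenvalues of Jordan blocks, number and sizes of the Jordan blocks for each eigenvalue, horizontal and vertical indices (with multiplicity). The Jordan--Kronecker (JK) invariants of $\rho$ are the algebraic type of $R_{a+\lambda b}$ for a generic pair $(a,b)\in W\times W$ (i.e. for all pairs in some non-empty Zariski open subset). Congruence action. In a fixed basis of $V$, the group $\mathrm{GL}(V)$ acts on bilinear forms (square matrices $Q$) by $(P,Q)\mapsto PQP^T$; the corresponding Lie algebra representation is $\rho(X)Q=XQ+QX^T$. Here it is restricted to skew-symmetric matrices $Q\in\Lambda^2(V)$. *)

theory Defs
  imports "Jordan_Normal_Form.VS_Connect" "Jordan_Normal_Form.Jordan_Normal_Form"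
begin

section \<open>Canonical blocks of a pencil\<close>

datatype eigval = Finite_eigval complex | Infinite_eigval

datatype kronecker_block =
    is_jordan: Jordan (index: nat) (block_eigval: eigval)
  | is_horizontal: Horizontal (index: nat)
  | is_vertical: Vertical (index: nat)

text \<open>For \<open>h \<ge> 1\<close> these are the matrices \<open>(0 | I)\<close> and \<open>(I | 0)\<close> of size
  \<open>(h - 1) \<times> h\<close>; for \<open>h = 1\<close> both are the \<open>0 \<times> 1\<close> matrix.\<close>

definition shift_right :: "nat \<Rightarrow> complex mat" where
  "shift_right h = mat (h - 1) h (\<lambda>(i, j). if j = i + 1 then 1 else 0)"

definition shift_left :: "nat \<Rightarrow> complex mat" where
  "shift_left h = mat (h - 1) h (\<lambda>(i, j). if j = i then 1 else 0)"

fun block_A :: "kronecker_block \<Rightarrow> complex mat" where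
  "block_A (Jordan k (Finite_eigval \<mu>)) = jordan_block k \<mu>"
| "block_A (Jordan k Infinite_eigval) = 1\<^sub>m k"
| "block_A (Horizontal h) = shift_right h"
| "block_A (Vertical v) = transpose_mat (shift_right v)"

fun block_B :: "kronecker_block \<Rightarrow> complex mat" where
  "block_B (Jordan k (Finite_eigval \<mu>)) = 1\<^sub>m k"
| "block_B (Jordan k Infinite_eigval) = jordan_block k 0"
| "block_B (Horizontal h) = shift_left h"
| "block_B (Vertical v) = transpose_mat (shift_left v)"

section \<open>The algebraic type of a pencil of linear maps\<close>

text \<open>Vector spaces over the complex numbers are modules over \<^term>\<open>class_ring\<close>.\<close>

definition ordered_basis :: "(complex, 'a) module \<Rightarrow> 'a list \<Rightarrow> bool" where
  "ordered_basis V vs \<longleftrightarrow> distinct vs \<and> vectorspace.basis class_ring V (set vs)"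

definition represents ::
  "(complex, 'b) module \<Rightarrow> 'a list \<Rightarrow> 'b list \<Rightarrow> ('a \<Rightarrow> 'b) \<Rightarrow> complex mat \<Rightarrow> bool" where
  "represents V us vs f M \<longleftrightarrow>
     M \<in> carrier_mat (length vs) (length us) \<and>
     (\<forall>j < length us. f (us ! j) =
        (\<Oplus>\<^bsub>V\<^esub>i \<in> {..<length vs}. M $$ (i, j) \<odot>\<^bsub>V\<^esub> vs ! i))"

definition kronecker_form ::
  "(complex, 'a) module \<Rightarrow> (complex, 'b) module \<Rightarrow> ('a \<Rightarrow> 'b) \<Rightarrow> ('a \<Rightarrow> 'b)
    \<Rightarrow> kronecker_block list \<Rightarrow> bool" where
  "kronecker_form U V A B bs \<longleftrightarrow>
     (\<forall>b \<in> set bs. index b \<ge> 1) \<and>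
     (\<exists>us vs. ordered_basis U us \<and> ordered_basis V vs \<and>
        represents V us vs A (diag_block_mat (map block_A bs)) \<and>
        represents V us vs B (diag_block_mat (map block_B bs)))"

text \<open>The field \<open>jordan_sizes\<close> contains, for each distinct eigenvalue, the multiset of the
  sizes of its Jordan blocks; its size is the number of distinct eigenvalues. The values of the
  eigenvalues are not part of the type.\<close>

record algebraic_type =
  jordan_sizes :: "nat multiset multiset"
  horizontal_indices :: "nat multiset"
  vertical_indices :: "nat multiset"

definition type_of_blocks :: "kronecker_block list \<Rightarrow> algebraic_type" where
  "type_of_blocks bs = \<lparr>
     jordan_sizes =
       image_mset (\<lambda>\<mu>. image_mset index {# b \<in># mset bs. is_jordan b \<and> block_eigval b = \<mu> #})
         (mset_set (block_eigval ` {b \<in> set bs. is_jordan b})),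
     horizontal_indices = image_mset index {# b \<in># mset bs. is_horizontal b #},
     vertical_indices = image_mset index {# b \<in># mset bs. is_vertical b #} \<rparr>"

text \<open>Stated as a relation, because Kronecker's theorem (existence and uniqueness of the
  block decomposition) is what makes the type a function of the pencil.\<close>

definition has_algebraic_type ::
  "(complex, 'a) module \<Rightarrow> (complex, 'b) module \<Rightarrow> ('a \<Rightarrow> 'b) \<Rightarrow> ('a \<Rightarrow> 'b)
    \<Rightarrow> algebraic_type \<Rightarrow> bool" where
  "has_algebraic_type U V A B T \<longleftrightarrow>
     (\<exists>bs. kronecker_form U V A B bs \<and> type_of_blocks bs = T)"

section \<open>Zariski open sets in a vector space\<close>

definition scalar_module :: "(complex, complex) module" where
  "scalar_module =
     \<lparr>carrier = UNIV, monoid.mult = (*), one = 1, zero = 0, add = (+), module.smult = (*)\<rparr>"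

text \<open>Polynomial functions on \<open>X\<close> are those generated by the linear functionals; only their
  values on \<open>carrier X\<close> matter.\<close>

inductive poly_fun :: "(complex, 'a) module \<Rightarrow> ('a \<Rightarrow> complex) \<Rightarrow> bool" for X where
  linear: "linear_map class_ring X scalar_module f \<Longrightarrow> poly_fun X f"
| const: "poly_fun X (\<lambda>_. c)"
| add: "poly_fun X p \<Longrightarrow> poly_fun X q \<Longrightarrow> poly_fun X (\<lambda>x. p x + q x)"
| mult: "poly_fun X p \<Longrightarrow> poly_fun X q \<Longrightarrow> poly_fun X (\<lambda>x. p x * q x)"

definition zariski_closed :: "(complex, 'a) module \<Rightarrow> 'a set \<Rightarrow> bool" where
  "zariski_closed X C \<longleftrightarrow>
     (\<exists>P. (\<forall>p \<in> P. poly_fun X p) \<and> C = {x \<in> carrier X. \<forall>p \<in> P. p x = 0})"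

definition zariski_open :: "(complex, 'a) module \<Rightarrow> 'a set \<Rightarrow> bool" where
  "zariski_open X S \<longleftrightarrow> S \<subseteq> carrier X \<and> zariski_closed X (carrier X - S)"

section \<open>Jordan--Kronecker invariants of a representation\<close>

text \<open>The representation \<open>\<rho>\<close> of \<open>\<gg>\<close> on \<open>W\<close> is curried, so that
  \<open>R\<^sub>x = (\<lambda>\<xi>. \<rho> \<xi> x)\<close>.\<close>

definition has_JK_invariants ::
  "(complex, 'g) module \<Rightarrow> (complex, 'w) module \<Rightarrow> ('g \<Rightarrow> 'w \<Rightarrow> 'w) \<Rightarrow> algebraic_type \<Rightarrow> bool" where
  "has_JK_invariants \<gg> W \<rho> T \<longleftrightarrow>
     (\<exists>S. zariski_open (direct_sum W W) S \<and> S \<noteq> {} \<and>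
        (\<forall>(a, b) \<in> S. has_algebraic_type \<gg> W (\<lambda>\<xi>. \<rho> \<xi> a) (\<lambda>\<xi>. \<rho> \<xi> b) T))"

section \<open>The congruence action on skew-symmetric matrices\<close>

abbreviation gl :: "nat \<Rightarrow> (complex, complex mat) module" where
  "gl m \<equiv> module_mat TYPE(complex) m m"

definition skew_mats :: "nat \<Rightarrow> complex mat set" where
  "skew_mats m = {Q \<in> carrier_mat m m. transpose_mat Q = - Q}"

definition Lambda2 :: "nat \<Rightarrow> (complex, complex mat) module" where
  "Lambda2 m = (gl m)\<lparr>carrier := skew_mats m\<rparr>"

definition congruence_rep :: "complex mat \<Rightarrow> complex mat \<Rightarrow> complex mat" where
  "congruence_rep X Q = X * Q + Q * transpose_mat X"

lemma skew_mats_closed: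
  "0\<^sub>m m m \<in> skew_mats m"
  "A \<in> skew_mats m \<Longrightarrow> B \<in> skew_mats m \<Longrightarrow> A + B \<in> skew_mats m"
  "A \<in> skew_mats m \<Longrightarrow> c \<cdot>\<^sub>m A \<in> skew_mats m"
proof -
  show "0\<^sub>m m m \<in> skew_mats m"
    by (auto simp: skew_mats_def)
  show "A + B \<in> skew_mats m" if "A \<in> skew_mats m" "B \<in> skew_mats m"
  proof -
    have "A \<in> carrier_mat m m" "B \<in> carrier_mat m m"
      "transpose_mat A = - A" "transpose_mat B = - B"
      using that by (auto simp: skew_mats_def)
    moreover from this have "- A + - B = - (A + B)" by (intro eq_matI) auto
    ultimately show ?thesis
      using transpose_add[of A m m B] by (simp add: skew_mats_def)
  qed
  show "c \<cdot>\<^sub>m A \<in> skew_mats m" if "A \<in> skew_mats m"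
  proof -
    have A: "A \<in> carrier_mat m m" "transpose_mat A = - A"
      using that by (auto simp: skew_mats_def)
    have "transpose_mat (c \<cdot>\<^sub>m A) = c \<cdot>\<^sub>m transpose_mat A" by (intro eq_matI) auto
    also have "\<dots> = - (c \<cdot>\<^sub>m A)" unfolding A(2) by (intro eq_matI) auto
    finally show ?thesis using A(1) by (simp add: skew_mats_def)
  qed
qed

lemma Lambda2_simps [simp]:
  "carrier (Lambda2 m) = skew_mats m" "add (Lambda2 m) = (+)" "module.smult (Lambda2 m) = (\<cdot>\<^sub>m)"
  by (simp_all add: Lambda2_def module_mat_simps)

lemma Lambda2_vectorspace: "vectorspace class_ring (Lambda2 m)"
proof -
  interpret vectorspace "class_ring :: complex ring" "gl m"
    by (rule matrix_vs)
  have "skew_mats m \<subseteq> carrier_mat m m" by (auto simp: skew_mats_def)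
  then have "submodule class_ring (skew_mats m) (gl m)"
    by (intro submodule.intro module_axioms)
      (simp_all add: submodule_axioms_def module_mat_simps skew_mats_closed)
  then show ?thesis
    unfolding Lambda2_def
    by (intro subspace_is_vs) (simp add: VectorSpace.subspace_def vectorspace_axioms)
qed

lemma congruence_rep_skew:
  assumes "X \<in> carrier_mat m m" "Q \<in> skew_mats m"
  shows "congruence_rep X Q \<in> skew_mats m"
proof -
  have Q: "Q \<in> carrier_mat m m" "transpose_mat Q = - Q"
    using assms(2) by (auto simp: skew_mats_def)
  have XQ: "X * Q \<in> carrier_mat m m" "Q * transpose_mat X \<in> carrier_mat m m"
    using assms(1) Q by auto
  have "transpose_mat (X * Q) = - (Q * transpose_mat X)"
       "transpose_mat (Q * transpose_mat X) = - (X * Q)"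
    using assms(1) Q by (simp_all add: transpose_mult[where nr=m and n=m and nc=m])
  moreover have "- B + - A = - (A + B)"
    if "A \<in> carrier_mat m m" "B \<in> carrier_mat m m" for A B :: "complex mat"
    using that by (intro eq_matI) auto
  ultimately have "transpose_mat (congruence_rep X Q) = - congruence_rep X Q"
    unfolding congruence_rep_def using XQ transpose_add[OF XQ] by simp
  then show ?thesis
    using XQ by (simp add: skew_mats_def congruence_rep_def)
qed

lemma congruence_rep_arg_linear:
  assumes "X \<in> carrier_mat m m" "Y \<in> carrier_mat m m" "Q \<in> carrier_mat m m"
  shows "congruence_rep (X + Y) Q = congruence_rep X Q + congruence_rep Y Q"
    and "congruence_rep (c \<cdot>\<^sub>m X) Q = c \<cdot>\<^sub>m congruence_rep X Q"
proof -
  have c: "X * Q \<in> carrier_mat m m" "Y * Q \<in> carrier_mat m m"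
    "Q * transpose_mat X \<in> carrier_mat m m" "Q * transpose_mat Y \<in> carrier_mat m m"
    using assms by auto
  have "(X + Y) * Q = X * Q + Y * Q"
    "Q * transpose_mat (X + Y) = Q * transpose_mat X + Q * transpose_mat Y"
    using assms
    by (simp_all add: add_mult_distrib_mat[where nr = m and n = m and nc = m]
        transpose_add[where nr = m and nc = m]
        mult_add_distrib_mat[where nr = m and n = m and nc = m])
  then show "congruence_rep (X + Y) Q = congruence_rep X Q + congruence_rep Y Q"
    unfolding congruence_rep_def using c by (intro eq_matI) auto
  have "transpose_mat (c \<cdot>\<^sub>m X) = c \<cdot>\<^sub>m transpose_mat X"
    by (intro eq_matI) auto
  then have "(c \<cdot>\<^sub>m X) * Q = c \<cdot>\<^sub>m (X * Q)"
    "Q * transpose_mat (c \<cdot>\<^sub>m X) = c \<cdot>\<^sub>m (Q * transpose_mat X)"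
    using assms mult_smult_distrib[of Q m m "transpose_mat X" m c]
    by (simp_all add: mult_smult_assoc_mat[where nr = m and n = m and nc = m])
  then show "congruence_rep (c \<cdot>\<^sub>m X) Q = c \<cdot>\<^sub>m congruence_rep X Q"
    unfolding congruence_rep_def
    using add_smult_distrib_left_mat[OF c(1,3), of c] by simp
qed

lemma congruence_rep_form_linear:
  assumes "X \<in> carrier_mat m m" "Q \<in> carrier_mat m m" "Q' \<in> carrier_mat m m"
  shows "congruence_rep X (Q + Q') = congruence_rep X Q + congruence_rep X Q'"
    and "congruence_rep X (c \<cdot>\<^sub>m Q) = c \<cdot>\<^sub>m congruence_rep X Q"
proof -
  have c: "X * Q \<in> carrier_mat m m" "X * Q' \<in> carrier_mat m m"
    "Q * transpose_mat X \<in> carrier_mat m m" "Q' * transpose_mat X \<in> carrier_mat m m"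
    using assms by auto
  have "X * (Q + Q') = X * Q + X * Q'"
    "(Q + Q') * transpose_mat X = Q * transpose_mat X + Q' * transpose_mat X"
    using assms
    by (simp_all add: add_mult_distrib_mat[where nr = m and n = m and nc = m]
        mult_add_distrib_mat[where nr = m and n = m and nc = m])
  then show "congruence_rep X (Q + Q') = congruence_rep X Q + congruence_rep X Q'"
    unfolding congruence_rep_def using c by (intro eq_matI) auto
  have "X * (c \<cdot>\<^sub>m Q) = c \<cdot>\<^sub>m (X * Q)"
    "(c \<cdot>\<^sub>m Q) * transpose_mat X = c \<cdot>\<^sub>m (Q * transpose_mat X)"
    using assms mult_smult_distrib[of X m m Q m c]
    by (simp_all add: mult_smult_assoc_mat[where nr = m and n = m and nc = m])
  then show "congruence_rep X (c \<cdot>\<^sub>m Q) = c \<cdot>\<^sub>m congruence_rep X Q"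
    unfolding congruence_rep_def
    using add_smult_distrib_left_mat[OF c(1,3), of c] by simp
qed

lemma congruence_rep_bracket:
  assumes X: "X \<in> carrier_mat m m" and Y: "Y \<in> carrier_mat m m" and Q: "Q \<in> carrier_mat m m"
  shows "congruence_rep (X * Y - Y * X) Q =
    congruence_rep X (congruence_rep Y Q) - congruence_rep Y (congruence_rep X Q)"
proof -
  define X' Y' where "X' = transpose_mat X" and "Y' = transpose_mat Y"
  have X': "X' \<in> carrier_mat m m" and Y': "Y' \<in> carrier_mat m m"
    using X Y by (auto simp: X'_def Y'_def)
  have T: "transpose_mat (X * Y - Y * X) = Y' * X' - X' * Y'"
    using X Y transpose_minus[of "X * Y" m m "Y * X"] transpose_mult[OF X Y] transpose_mult[OF Y X]
    by (simp add: X'_def Y'_def)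
  have 1: "(X * Y - Y * X) * Q = X * (Y * Q) - Y * (X * Q)"
    using X Y Q minus_mult_distrib_mat[of "X * Y" m m "Y * X" Q m]
      assoc_mult_mat[OF X Y Q] assoc_mult_mat[OF Y X Q] by simp
  have 2: "Q * (Y' * X' - X' * Y') = (Q * Y') * X' - (Q * X') * Y'"
    using X' Y' Q mult_minus_distrib_mat[of Q m m "Y' * X'" m "X' * Y'"]
      assoc_mult_mat[OF Q X' Y'] assoc_mult_mat[OF Q Y' X'] by simp
  have 3: "A * (B * Q + Q * B') + (B * Q + Q * B') * A' =
      (A * (B * Q) + (A * Q) * B') + (B * (Q * A') + (Q * B') * A')"
    if "A \<in> carrier_mat m m" "B \<in> carrier_mat m m" "A' \<in> carrier_mat m m" "B' \<in> carrier_mat m m"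
    for A B A' B'
  proof -
    have "A * (B * Q + Q * B') = A * (B * Q) + A * (Q * B')"
      by (rule mult_add_distrib_mat) (use that Q in auto)
    moreover have "(B * Q + Q * B') * A' = (B * Q) * A' + (Q * B') * A'"
      by (rule add_mult_distrib_mat) (use that Q in auto)
    ultimately show ?thesis
      using assoc_mult_mat[OF that(1) Q that(4)] assoc_mult_mat[OF that(2) Q that(3)] by simp
  qed
  have 4: "(X * Q) * Y' = X * (Q * Y')" "(Y * Q) * X' = Y * (Q * X')"
    using X Y Q X' Y' by (auto intro: assoc_mult_mat)
  have c: "X * (Y * Q) \<in> carrier_mat m m" "Y * (X * Q) \<in> carrier_mat m m"
    "(Q * Y') * X' \<in> carrier_mat m m" "(Q * X') * Y' \<in> carrier_mat m m"
    "X * (Q * Y') \<in> carrier_mat m m" "Y * (Q * X') \<in> carrier_mat m m"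
    using X Y Q X' Y' by (auto intro!: mult_carrier_mat[of _ m m])
  have "P1 - P2 + (P3 - P4) = (P1 + P5 + (P6 + P3)) - (P2 + P6 + (P5 + P4))"
    if "P1 \<in> carrier_mat m m" "P2 \<in> carrier_mat m m" "P3 \<in> carrier_mat m m"
      "P4 \<in> carrier_mat m m" "P5 \<in> carrier_mat m m" "P6 \<in> carrier_mat m m"
    for P1 P2 P3 P4 P5 P6 :: "complex mat"
    using that by (intro eq_matI) auto
  from this[OF c] show ?thesis
    unfolding congruence_rep_def T 1 2 X'_def[symmetric] Y'_def[symmetric]
      3[OF X Y X' Y'] 3[OF Y X Y' X'] 4 .
qed

lemma congruence_rep_linear_maps:
  shows "Q \<in> skew_mats m \<Longrightarrow> linear_map class_ring (gl m) (Lambda2 m) (\<lambda>X. congruence_rep X Q)"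
    and "X \<in> carrier_mat m m \<Longrightarrow> linear_map class_ring (Lambda2 m) (Lambda2 m) (congruence_rep X)"
proof -
  have V: "vectorspace (class_ring :: complex ring) (gl m)" by (rule matrix_vs)
  have W: "vectorspace (class_ring :: complex ring) (Lambda2 m)" by (rule Lambda2_vectorspace)
  have sub: "A \<in> skew_mats m \<Longrightarrow> A \<in> carrier_mat m m" for A by (simp add: skew_mats_def)
  show "linear_map class_ring (gl m) (Lambda2 m) (\<lambda>X. congruence_rep X Q)"
    if Q: "Q \<in> skew_mats m"
  proof -
    have "(\<lambda>X. congruence_rep X Q) \<in> LinearCombinations.module_hom class_ring (gl m) (Lambda2 m)"
      unfolding LinearCombinations.module_hom_def module_mat_simps Lambda2_simps mem_Collect_eq
      by (intro conjI allI impI Pi_I)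
        ((elim conjE)?, rule congruence_rep_skew congruence_rep_arg_linear; (assumption | rule Q sub[OF Q]))+
    then show ?thesis
      using V W by (simp add: linear_map_def mod_hom_def mod_hom_axioms_def vectorspace_def)
  qed
  show "linear_map class_ring (Lambda2 m) (Lambda2 m) (congruence_rep X)"
    if X: "X \<in> carrier_mat m m"
  proof -
    have "congruence_rep X \<in> LinearCombinations.module_hom class_ring (Lambda2 m) (Lambda2 m)"
      unfolding LinearCombinations.module_hom_def Lambda2_simps mem_Collect_eq
      by (intro conjI allI impI Pi_I)
        ((elim conjE)?, rule congruence_rep_skew congruence_rep_form_linear; (assumption | rule X | erule sub))+
    then show ?thesis
      using W by (simp add: linear_map_def mod_hom_def mod_hom_axioms_def vectorspace_def)
  qed
qed

end

(* Let b be invertible with N = adj(b) a having n distinct eigenvalues. Since a - z b is skew of even size,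
   each of its kernels has dimension at least 2, so b^(-1) a = S L S^(-1) with L diagonal and each
   eigenvalue of multiplicity 2. Writing X = P U S^(-1) b^(-1) with P = S^(-T) turns the pencil into
   R_b: U |-> P (U - U^T) P^T and R_a: U |-> P (U L - (U L)^T) P^T, and the elementary matrices
   E_ij, E_ji together with E_ij - E_ji then split off a Kronecker block each.
   Having n distinct eigenvalues is a Zariski open condition: the matrix of the power sums
   tr N^(i+j) for i, j < n is singular if there are fewer. *)

theory Submission
  imports Defs "Jordan_Normal_Form.Schur_Decomposition"
begin

section \<open>Bases and transport of the algebraic type\<close>

text \<open>For skew Q the action is X Q - (X Q)^T, so the pencil sees X only through X a and X b.
  In the coordinate U given by X b = P U P^T, every eigenbasis S yields X a = P U L P^T; hence S may
  be assembled from arbitrary kernel vectors, with no normalization of b on the eigenspaces. The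
  kernels have dimension at least 2 because a skew matrix of odd size is singular, which is applied
  to a - z b bordered by one row and one column. So n distinct eigenvalues already fill the space of
  dimension 2n, and genericity has to supply no more than invertibility of b and these n
  eigenvalues. The adjugate stands in for the inverse so that N is polynomial in the entries of a
  and b; its eigenvalues are det b times those of the pencil, and this factor is divided out at the
  end.\<close>

lemma scalar_module_simps [simp]:
  "carrier scalar_module = UNIV" "add scalar_module = (+)" "zero scalar_module = 0"
  "module.smult scalar_module = (*)"
  by (simp_all add: scalar_module_def)

lemma scalar_module_vectorspace: "vectorspace class_ring scalar_module"
proof -
  have "abelian_group scalar_module"
    by (rule abelian_groupI) (auto intro: exI[of _ "- x" for x] simp: algebra_simps)
  then interpret abelian_group scalar_module .
  show ?thesis
    unfolding class_field_def by unfold_locales (auto simp: class_ring_simps algebra_simps)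
qed

lemma finsum_scalar_module: "finsum scalar_module f A = sum f A"
proof -
  interpret vectorspace class_ring scalar_module
    by (rule scalar_module_vectorspace)
  show ?thesis
    by (induction A rule: infinite_finite_induct) (auto simp: finsum_insert)
qed

lemma linear_mapI:
  assumes "vectorspace class_ring V" "vectorspace class_ring W"
    and "\<And>x. x \<in> carrier V \<Longrightarrow> f x \<in> carrier W"
    and "\<And>x y. x \<in> carrier V \<Longrightarrow> y \<in> carrier V \<Longrightarrow> f (x \<oplus>\<^bsub>V\<^esub> y) = f x \<oplus>\<^bsub>W\<^esub> f y"
    and "\<And>c x. x \<in> carrier V \<Longrightarrow> f (c \<odot>\<^bsub>V\<^esub> x) = c \<odot>\<^bsub>W\<^esub> f x"
  shows "linear_map class_ring V W f"
proof -
  have "f \<in> LinearCombinations.module_hom class_ring V W"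
    using assms(3-5) unfolding LinearCombinations.module_hom_def by auto
  then show ?thesis
    using assms(1,2) by (simp add: linear_map_def mod_hom_def mod_hom_axioms_def vectorspace_def)
qed

lemma (in mod_hom) hom_finsum:
  assumes "g \<in> A \<rightarrow> carrier M"
  shows "f (finsum M g A) = finsum N (\<lambda>a. f (g a)) A"
  using assms
proof (induction A rule: infinite_finite_induct)
  case (insert a A)
  then have "finsum N (\<lambda>a. f (g a)) (insert a A) = f (g a) \<oplus>\<^bsub>N\<^esub> finsum N (\<lambda>a. f (g a)) A"
    by (intro N.M.finsum_insert) auto
  with insert show ?case
    by (simp add: Pi_iff)
qed auto

text \<open>Applying \<open>\<phi> p\<close> to a linear combination returns its coefficient at
  \<open>u p\<close>. A vanishing combination therefore has zero coefficients, and any x agrees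
  under all \<open>\<phi> p\<close> with the combination that has coefficients
  \<open>\<phi> p x\<close>, so separation makes them equal.\<close>

lemma ordered_basis_dual:
  fixes V :: "(complex, 'a) module"
  assumes V: "vectorspace class_ring V"
    and ps: "distinct ps"
    and u: "\<And>p. p \<in> set ps \<Longrightarrow> u p \<in> carrier V"
    and lin: "\<And>p. p \<in> set ps \<Longrightarrow> linear_map class_ring V scalar_module (\<phi> p)"
    and dual: "\<And>p q. p \<in> set ps \<Longrightarrow> q \<in> set ps \<Longrightarrow> \<phi> p (u q) = (if p = q then 1 else 0)"
    and sep: "\<And>x y. x \<in> carrier V \<Longrightarrow> y \<in> carrier V \<Longrightarrow>
      (\<And>p. p \<in> set ps \<Longrightarrow> \<phi> p x = \<phi> p y) \<Longrightarrow> x = y"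
  shows "ordered_basis V (map u ps)"
proof -
  interpret V: vectorspace class_ring V by (rule V)
  define A where "A = u ` set ps"
  have A: "finite A" "A \<subseteq> carrier V"
    using u by (auto simp: A_def)
  have inj: "inj_on u (set ps)"
    using dual by (intro inj_onI) (metis zero_neq_one)
  have coord: "\<phi> p (V.lincomb a A) = a (u p)" if p: "p \<in> set ps" for a p
  proof -
    interpret T: linear_map class_ring V scalar_module "\<phi> p"
      by (rule lin[OF p])
    have "\<phi> p (V.lincomb a A) = (\<Sum>v\<in>A. a v * \<phi> p v)"
      unfolding V.lincomb_def using A
      by (subst T.hom_finsum) (auto simp: finsum_scalar_module class_ring_simps intro!: sum.cong)
    also have "\<dots> = (\<Sum>q\<in>set ps. a (u q) * \<phi> p (u q))"
      unfolding A_def by (subst sum.reindex[OF inj]) simp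
    also have "\<dots> = (\<Sum>q\<in>set ps. if q = p then a (u q) else 0)"
      using p by (intro sum.cong) (auto simp: dual)
    also have "\<dots> = a (u p)"
      using p by simp
    finally show ?thesis .
  qed
  have "V.lin_indpt A"
  proof (rule V.finite_lin_indpt2[OF A])
    fix a assume lc: "V.lincomb a A = \<zero>\<^bsub>V\<^esub>"
    have "a (u p) = 0" if p: "p \<in> set ps" for p
    proof -
      interpret T: linear_map class_ring V scalar_module "\<phi> p"
        by (rule lin[OF p])
      show ?thesis
        using coord[OF p, of a] lc by simp
    qed
    then show "\<forall>v\<in>A. a v = \<zero>\<^bsub>class_ring\<^esub>"
      by (simp add: A_def class_ring_simps)
  qed
  moreover have "x \<in> V.span A" if x: "x \<in> carrier V" for x
  proof -
    \<comment> \<open>\<open>lincomb\<close> takes coefficients indexed by vectors, while the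
      coordinates of x are indexed by \<open>ps\<close>; injectivity of \<open>u\<close> allows the
      translation.\<close>
    define a where "a v = \<phi> (inv_into (set ps) u v) x" for v
    have "x = V.lincomb a A"
    proof (rule sep[OF x])
      show "V.lincomb a A \<in> carrier V"
        using A by (intro V.lincomb_closed) (auto simp: class_ring_simps)
      show "\<phi> p x = \<phi> p (V.lincomb a A)" if "p \<in> set ps" for p
        using that inj by (simp add: coord a_def)
    qed
    then show ?thesis
      using A unfolding V.span_def by (auto simp: class_ring_simps)
  qed
  ultimately have "V.basis A"
    unfolding V.basis_def using A V.span_is_subset2[of A] by blast
  then show ?thesis
    using inj ps by (simp add: ordered_basis_def A_def distinct_map)
qed

text \<open>The chain dim \<le> card (set us) \<le> length us \<le> length es = dim collapses to
  equalities, which gives distinctness and independence together. It serves for the basis of gl(m)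
  adapted to the blocks, where spanning is easy to see and a dual system is not at hand.\<close>

lemma ordered_basis_spanning:
  fixes V :: "(complex, 'a) module"
  assumes V: "vectorspace class_ring V"
    and es: "ordered_basis V es"
    and us: "set us \<subseteq> carrier V" "length us \<le> length es"
    and span: "set es \<subseteq> LinearCombinations.module.span class_ring V (set us)"
  shows "ordered_basis V us"
proof -
  interpret V: vectorspace class_ring V by (rule V)
  have B: "V.basis (set es)" "distinct es"
    using es by (auto simp: ordered_basis_def)
  have fd: "V.fin_dim"
    unfolding V.fin_dim_def using B by (auto simp: V.basis_def)
  have dim: "V.dim = length es"
    using V.dim_basis[OF _ B(1)] B(2) by (simp add: distinct_card)
  have "V.span (set es) \<subseteq> V.span (set us)"
    using span V.span_is_submodule[OF us(1)] by (intro V.span_is_subset)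
  then have gen: "V.gen_set (set us)"
    using B us(1) V.span_is_subset2[OF us(1)] by (auto simp: V.basis_def)
  have "card (set us) = length us"
    using V.gen_ge_dim[OF _ us(1) gen] us(2) card_length[of us] dim by simp
  moreover from this have "V.basis (set us)"
    using us gen dim by (intro V.dim_gen_is_basis) auto
  ultimately show ?thesis
    by (simp add: ordered_basis_def card_distinct)
qed

lemma ordered_basis_map:
  fixes V :: "(complex, 'a) module" and W :: "(complex, 'b) module"
  assumes T: "linear_map class_ring V W T" and bij: "bij_betw T (carrier V) (carrier W)"
    and vs: "ordered_basis V vs"
  shows "ordered_basis W (map T vs)"
proof -
  interpret T: linear_map class_ring V W T by (rule T)
  have B: "T.V.basis (set vs)" "distinct vs"
    using vs by (auto simp: ordered_basis_def)
  have fd: "T.V.fin_dim"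
    unfolding T.V.fin_dim_def using B by (auto simp: T.V.basis_def)
  have "T.W.basis (T ` set vs)"
    using bij B fd by (intro T.linear_inj_image_is_basis) (auto simp: bij_betw_def)
  moreover have "inj_on T (set vs)"
    using bij B by (auto simp: bij_betw_def T.V.basis_def intro: inj_on_subset)
  ultimately show ?thesis
    using B by (simp add: ordered_basis_def distinct_map)
qed

lemma represents_map:
  assumes T: "linear_map class_ring V W T" and vs: "set vs \<subseteq> carrier V"
    and intertwine: "\<And>u. u \<in> set us \<Longrightarrow> g (\<phi> u) = T (f u)"
    and rep: "represents V us vs f M"
  shows "represents W (map \<phi> us) (map T vs) g M"
proof -
  interpret T: linear_map class_ring V W T by (rule T)
  have "T (\<Oplus>\<^bsub>V\<^esub>i \<in> {..<length vs}. M $$ (i, j) \<odot>\<^bsub>V\<^esub> vs ! i) =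
      (\<Oplus>\<^bsub>W\<^esub>i \<in> {..<length vs}. M $$ (i, j) \<odot>\<^bsub>W\<^esub> map T vs ! i)" for j
    using vs nth_mem[of _ vs]
    by (subst T.hom_finsum) (auto simp: class_ring_simps subset_iff intro!: T.W.module.M.finsum_cong')
  then show ?thesis
    using rep intertwine by (auto simp: represents_def)
qed

text \<open>Strict equivalence of pencils: when both bases are carried along by the isomorphisms,
  the block matrices themselves stay unchanged.\<close>

lemma has_algebraic_type_map:
  assumes \<phi>: "linear_map class_ring U U' \<phi>" "bij_betw \<phi> (carrier U) (carrier U')"
    and \<psi>: "linear_map class_ring V V' \<psi>" "bij_betw \<psi> (carrier V) (carrier V')"
    and A: "\<And>u. u \<in> carrier U \<Longrightarrow> A' (\<phi> u) = \<psi> (A u)"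
    and B: "\<And>u. u \<in> carrier U \<Longrightarrow> B' (\<phi> u) = \<psi> (B u)"
    and type: "has_algebraic_type U V A B T"
  shows "has_algebraic_type U' V' A' B' T"
proof -
  interpret F: linear_map class_ring U U' \<phi> by (rule \<phi>)
  interpret G: linear_map class_ring V V' \<psi> by (rule \<psi>)
  from type obtain bs us vs where bs: "type_of_blocks bs = T" "\<forall>b \<in> set bs. index b \<ge> 1"
    and us: "ordered_basis U us" and vs: "ordered_basis V vs"
    and rep: "represents V us vs A (diag_block_mat (map block_A bs))"
      "represents V us vs B (diag_block_mat (map block_B bs))"
    unfolding has_algebraic_type_def kronecker_form_def by blast
  have carr: "set us \<subseteq> carrier U" "set vs \<subseteq> carrier V"
    using us vs by (auto simp: ordered_basis_def F.V.basis_def G.V.basis_def)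
  have "represents V' (map \<phi> us) (map \<psi> vs) A' (diag_block_mat (map block_A bs))"
    "represents V' (map \<phi> us) (map \<psi> vs) B' (diag_block_mat (map block_B bs))"
    using represents_map[OF \<psi>(1) carr(2) _ rep(1), of A' \<phi>] represents_map[OF \<psi>(1) carr(2) _ rep(2), of B' \<phi>]
      A B carr(1) by auto
  with bs ordered_basis_map[OF \<phi> us] ordered_basis_map[OF \<psi> vs] show ?thesis
    unfolding has_algebraic_type_def kronecker_form_def by blast
qed

section \<open>Assembling a pencil from diagonal blocks\<close>

lemma (in abelian_monoid) finsum_lessThan_add:
  fixes a b :: nat
  assumes "f \<in> {..<a + b} \<rightarrow> carrier G"
  shows "finsum G f {..<a + b} = finsum G f {..<a} \<oplus> finsum G (\<lambda>i. f (a + i)) {..<b}"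
  using assms
proof (induction b)
  case 0
  then show ?case by (simp add: Pi_iff)
next
  case (Suc b)
  then show ?case
    by (simp add: lessThan_Suc Pi_iff finsum_insert a_ac)
qed

lemma represents_four_block_mat:
  fixes V :: "(complex, 'a) module"
  assumes V: "vectorspace class_ring V" and vs: "set vs \<subseteq> carrier V" "set vs' \<subseteq> carrier V"
    and rep: "represents V us vs f M" "represents V us' vs' f M'"
  shows "represents V (us @ us') (vs @ vs') f
    (four_block_mat M (0\<^sub>m (length vs) (length us')) (0\<^sub>m (length vs') (length us)) M')"
    (is "represents _ _ _ _ ?M")
proof -
  interpret V: vectorspace class_ring V by (rule V)
  have M: "M \<in> carrier_mat (length vs) (length us)" "M' \<in> carrier_mat (length vs') (length us')"
    using rep by (auto simp: represents_def)
  have in_V: "vs ! i \<in> carrier V" if "i < length vs" for i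
    using vs that by (auto simp: subset_iff)
  have in_V': "vs' ! i \<in> carrier V" if "i < length vs'" for i
    using vs that by (auto simp: subset_iff)
  have in_VV': "(vs @ vs') ! i \<in> carrier V" if "i < length vs + length vs'" for i
    using vs that by (auto simp: nth_append intro: in_V in_V')
  have zero: "finsum V g {..<k} = \<zero>\<^bsub>V\<^esub>" if "\<And>i. i < k \<Longrightarrow> g i = \<zero>\<^bsub>V\<^esub>" for g and k :: nat
    using that by (intro V.module.M.add.finprod_one_eqI) auto
  have "f ((us @ us') ! j) =
      (\<Oplus>\<^bsub>V\<^esub>i \<in> {..<length vs + length vs'}. ?M $$ (i, j) \<odot>\<^bsub>V\<^esub> (vs @ vs') ! i)"
    if j: "j < length us + length us'" for j
  proof -
    have "(\<Oplus>\<^bsub>V\<^esub>i \<in> {..<length vs + length vs'}. ?M $$ (i, j) \<odot>\<^bsub>V\<^esub> (vs @ vs') ! i) =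
      (\<Oplus>\<^bsub>V\<^esub>i \<in> {..<length vs}. ?M $$ (i, j) \<odot>\<^bsub>V\<^esub> (vs @ vs') ! i) \<oplus>\<^bsub>V\<^esub>
      (\<Oplus>\<^bsub>V\<^esub>i \<in> {..<length vs'}. ?M $$ (length vs + i, j) \<odot>\<^bsub>V\<^esub> (vs @ vs') ! (length vs + i))"
      using in_VV' by (intro V.finsum_lessThan_add) (auto simp: class_ring_simps)
    also have "\<dots> = f ((us @ us') ! j)"
    proof (cases "j < length us")
      case True
      have "(\<Oplus>\<^bsub>V\<^esub>i \<in> {..<length vs}. ?M $$ (i, j) \<odot>\<^bsub>V\<^esub> (vs @ vs') ! i) =
        (\<Oplus>\<^bsub>V\<^esub>i \<in> {..<length vs}. M $$ (i, j) \<odot>\<^bsub>V\<^esub> vs ! i)"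
        using True M in_V
        by (intro V.module.M.finsum_cong') (auto simp: nth_append class_ring_simps)
      moreover have "(\<Oplus>\<^bsub>V\<^esub>i \<in> {..<length vs'}. ?M $$ (length vs + i, j) \<odot>\<^bsub>V\<^esub> (vs @ vs') ! (length vs + i)) = \<zero>\<^bsub>V\<^esub>"
        using True M in_V' V.lmult_0 by (intro zero) (auto simp: class_ring_simps)
      moreover have "(\<Oplus>\<^bsub>V\<^esub>i \<in> {..<length vs}. M $$ (i, j) \<odot>\<^bsub>V\<^esub> vs ! i) \<in> carrier V"
        using in_V by (intro V.finsum_closed) (auto simp: class_ring_simps)
      ultimately show ?thesis
        using True rep(1) by (simp add: represents_def nth_append)
    next
      case False
      then have j': "j - length us < length us'" using j by simp
      have "(\<Oplus>\<^bsub>V\<^esub>i \<in> {..<length vs'}. ?M $$ (length vs + i, j) \<odot>\<^bsub>V\<^esub> (vs @ vs') ! (length vs + i)) =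
        (\<Oplus>\<^bsub>V\<^esub>i \<in> {..<length vs'}. M' $$ (i, j - length us) \<odot>\<^bsub>V\<^esub> vs' ! i)"
        using False j' M in_V'
        by (intro V.module.M.finsum_cong') (auto simp: nth_append class_ring_simps)
      moreover have "(\<Oplus>\<^bsub>V\<^esub>i \<in> {..<length vs}. ?M $$ (i, j) \<odot>\<^bsub>V\<^esub> (vs @ vs') ! i) = \<zero>\<^bsub>V\<^esub>"
        using False j' M in_V V.lmult_0 by (intro zero) (auto simp: class_ring_simps nth_append)
      moreover have "(\<Oplus>\<^bsub>V\<^esub>i \<in> {..<length vs'}. M' $$ (i, j - length us) \<odot>\<^bsub>V\<^esub> vs' ! i) \<in> carrier V"
        using in_V' by (intro V.finsum_closed) (auto simp: class_ring_simps)
      ultimately show ?thesis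
        using False j' rep(2) by (simp add: represents_def nth_append)
    qed
    finally show ?thesis ..
  qed
  then show ?thesis
    using M by (auto simp: represents_def)
qed

text \<open>Reduces a Kronecker form to a check of one block at a time, each with its own piece of
  both bases. A piece may be empty, as the target piece of a zero column is.\<close>

lemma represents_diag_block_mat:
  fixes V :: "(complex, 'a) module" and us :: "'i \<Rightarrow> 'b list"
  assumes V: "vectorspace class_ring V"
    and "\<And>t. t \<in> set ts \<Longrightarrow> set (vs t) \<subseteq> carrier V"
    and "\<And>t. t \<in> set ts \<Longrightarrow> represents V (us t) (vs t) f (M t)"
  shows "represents V (concat (map us ts)) (concat (map vs ts)) f (diag_block_mat (map M ts))"
  using assms(2,3)
proof (induction ts)
  case Nil
  then show ?case by (simp add: represents_def)
next
  case (Cons t ts)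
  have IH: "represents V (concat (map us ts)) (concat (map vs ts)) f (diag_block_mat (map M ts))"
    using Cons by simp
  have "M t \<in> carrier_mat (length (vs t)) (length (us t))"
    "diag_block_mat (map M ts) \<in> carrier_mat (length (concat (map vs ts))) (length (concat (map us ts)))"
    using IH Cons.prems(2)[of t] by (auto simp: represents_def)
  then have "diag_block_mat (map M (t # ts)) = four_block_mat (M t)
      (0\<^sub>m (length (vs t)) (length (concat (map us ts))))
      (0\<^sub>m (length (concat (map vs ts))) (length (us t))) (diag_block_mat (map M ts))"
    by (auto simp: Let_def)
  moreover have "set (concat (map vs ts)) \<subseteq> carrier V"
    using Cons.prems(1) by (simp add: UN_subset_iff)
  ultimately show ?case
    using represents_four_block_mat[OF V Cons.prems(1)[of t] _ Cons.prems(2)[of t] IH]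
    by simp
qed

section \<open>The pencil in normal form\<close>

definition elem_mat :: "nat \<Rightarrow> nat \<times> nat \<Rightarrow> complex mat" where
  "elem_mat m p = mat m m (\<lambda>q. if q = p then 1 else 0)"

definition wedge_mat :: "nat \<Rightarrow> nat \<times> nat \<Rightarrow> complex mat" where
  "wedge_mat m p = elem_mat m p - elem_mat m (prod.swap p)"

text \<open>For \<open>L = diag (l\<^sub>0, l\<^sub>1, \<dots>)\<close> this is \<open>U L - (U L)\<^sup>T\<close>.\<close>

definition skew_part :: "nat \<Rightarrow> (nat \<Rightarrow> complex) \<Rightarrow> complex mat \<Rightarrow> complex mat" where
  "skew_part m l U = mat m m (\<lambda>(i, j). U $$ (i, j) * l j - U $$ (j, i) * l i)"

lemma elem_mat_carrier [simp]: "elem_mat m p \<in> carrier_mat m m"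
  by (simp add: elem_mat_def)

lemma wedge_mat_carrier [simp]: "wedge_mat m p \<in> carrier_mat m m"
  by (simp add: wedge_mat_def minus_carrier_mat)

lemma dim_elem_mat [simp]:
  "dim_row (elem_mat m p) = m" "dim_col (elem_mat m p) = m"
  "dim_row (wedge_mat m p) = m" "dim_col (wedge_mat m p) = m"
  by (simp_all add: elem_mat_def wedge_mat_def)

lemma wedge_mat_skew [simp]: "wedge_mat m p \<in> skew_mats m"
proof -
  have "transpose_mat (wedge_mat m p) $$ (i, j) = (- wedge_mat m p) $$ (i, j)" if "i < m" "j < m" for i j
  proof -
    have "(j, i) = prod.swap p \<longleftrightarrow> (i, j) = p" "(i, j) = prod.swap p \<longleftrightarrow> (j, i) = p"
      by (cases p; auto)+
    with that show ?thesis
      by (simp add: wedge_mat_def elem_mat_def)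
  qed
  note entry = this
  have "transpose_mat (wedge_mat m p) = - wedge_mat m p"
    by (rule eq_matI, rule entry) simp_all
  then show ?thesis
    by (simp add: skew_mats_def)
qed

lemma linear_map_entry:
  assumes V: "vectorspace class_ring V" and C: "carrier V \<subseteq> carrier_mat r c"
    and ops: "add V = (+)" "module.smult V = (\<cdot>\<^sub>m)" and p: "fst p < r" "snd p < c"
  shows "linear_map class_ring V scalar_module (\<lambda>Q. Q $$ p)"
proof -
  have "Q \<in> carrier V \<Longrightarrow> dim_row Q = r \<and> dim_col Q = c" for Q
    using C by auto
  then show ?thesis
    using p by (cases p) (auto intro!: linear_mapI[OF V scalar_module_vectorspace] simp: ops)
qed

lemma ordered_basis_elem_mat:
  "ordered_basis (gl m) (map (elem_mat m) (List.product [0..<m] [0..<m]))"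
proof (rule ordered_basis_dual[where \<phi> = "\<lambda>p Q. Q $$ p"])
  show "vectorspace class_ring (gl m)"
    by (rule matrix_vs)
  show "linear_map class_ring (gl m) scalar_module (\<lambda>Q. Q $$ p)"
    if "p \<in> set (List.product [0..<m] [0..<m])" for p
    using that by (intro linear_map_entry[OF matrix_vs, where r = m and c = m]) (auto simp: module_mat_simps)
qed (auto simp: module_mat_simps elem_mat_def distinct_product intro!: eq_matI split: if_splits)

lemma skew_mats_swap:
  assumes "C \<in> skew_mats m" "i < m" "j < m"
  shows "C $$ (j, i) = - C $$ (i, j)"
proof -
  have "transpose_mat C $$ (i, j) = (- C) $$ (i, j)" "C \<in> carrier_mat m m"
    using assms(1) by (simp_all add: skew_mats_def)
  then show ?thesis
    using assms(2,3) by simp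
qed

text \<open>The dual functionals are the entries above the diagonal; skewness determines all other
  entries. The order of \<open>ps\<close> is left free because the block list will put the pairs (k,
  k + n) before all others.\<close>

lemma ordered_basis_wedge_mat:
  assumes "distinct ps" and ps: "set ps = {(i, j). i < j \<and> j < m}"
  shows "ordered_basis (Lambda2 m) (map (wedge_mat m) ps)"
proof (rule ordered_basis_dual[where \<phi> = "\<lambda>p Q. Q $$ p"])
  show "vectorspace class_ring (Lambda2 m)"
    by (rule Lambda2_vectorspace)
  show "linear_map class_ring (Lambda2 m) scalar_module (\<lambda>Q. Q $$ p)" if "p \<in> set ps" for p
    using that by (intro linear_map_entry[OF Lambda2_vectorspace, where r = m and c = m])
      (auto simp: ps skew_mats_def)
  show "P = Q" if PQ: "P \<in> carrier (Lambda2 m)" "Q \<in> carrier (Lambda2 m)"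
    and eq: "\<And>p. p \<in> set ps \<Longrightarrow> P $$ p = Q $$ p" for P Q
  proof -
    show ?thesis
    proof (rule eq_matI)
      fix i j assume "i < dim_row Q" "j < dim_col Q"
      then have ij: "i < m" "j < m"
        using PQ by (auto simp: skew_mats_def)
      consider "i < j" | "j < i" | "i = j" by linarith
      then show "P $$ (i, j) = Q $$ (i, j)"
      proof cases
        case 1
        then show ?thesis using eq[of "(i, j)"] ij by (simp add: ps)
      next
        case 2
        then show ?thesis
          using eq[of "(j, i)"] ij PQ skew_mats_swap[of P m j i] skew_mats_swap[of Q m j i] by (simp add: ps)
      next
        case 3
        then show ?thesis
          using ij PQ skew_mats_swap[of P m i i] skew_mats_swap[of Q m i i] by simp
      qed
    qed (use PQ in \<open>auto simp: skew_mats_def\<close>)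
  qed
  show "wedge_mat m q $$ p = (if p = q then 1 else 0)" if "p \<in> set ps" "q \<in> set ps" for p q
  proof -
    have "fst p < snd p" "fst q < snd q" "snd p < m"
      using that by (auto simp: ps)
    moreover from this have "p \<noteq> prod.swap q"
      by auto
    ultimately show ?thesis
      by (cases p) (simp add: wedge_mat_def elem_mat_def)
  qed
qed (use assms(1) in simp_all)

lemma represents_single:
  fixes V :: "(complex, 'a) module"
  assumes V: "vectorspace class_ring V" and v: "v \<in> carrier V"
  shows "represents V us [v] f M \<longleftrightarrow>
    M \<in> carrier_mat 1 (length us) \<and> (\<forall>j < length us. f (us ! j) = M $$ (0, j) \<odot>\<^bsub>V\<^esub> v)"
proof -
  interpret V: vectorspace class_ring V by (rule V)
  have "finsum V g {..<Suc 0} = g 0" if "g 0 \<in> carrier V" for g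
    using that by (simp add: lessThan_Suc V.finsum_insert)
  then show ?thesis
    using v by (simp add: represents_def class_ring_simps)
qed

lemma represents_Nil_zero:
  fixes V :: "(complex, 'a) module"
  assumes V: "vectorspace class_ring V"
  shows "represents V us [] f M \<longleftrightarrow>
    M \<in> carrier_mat 0 (length us) \<and> (\<forall>u \<in> set us. f u = \<zero>\<^bsub>V\<^esub>)"
proof -
  interpret V: vectorspace class_ring V by (rule V)
  show ?thesis
    by (simp add: represents_def all_set_conv_all_nth)
qed

text \<open>Counts the blocks of width 2: there are n(2n - 1) pairs i < j, and the n pairs with
  equal eigenvalues are taken away.\<close>

lemma card_less_pairs: "card {(i, j). i < j \<and> j < 2 * n \<and> j \<noteq> i + n} = 2 * n * (n - 1)"
proof -
  have S: "{(i, j). i < j \<and> j < 2 * n} = prod.swap ` (SIGMA j:{..<2 * n}. {..<j})"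
    by (auto simp: image_iff)
  then have c: "card {(i, j). i < j \<and> j < 2 * n} = (\<Sum>j<2 * n. j)"
    and fin: "finite {(i, j). i < j \<and> j < 2 * n}"
    by (simp_all add: card_image)
  have "(\<Sum>j<2 * n. j) = n * (2 * n - 1)"
    by (induction n) (auto simp: algebra_simps)
  moreover have "{(i, j). i < j \<and> j < 2 * n \<and> j \<noteq> i + n} =
      {(i, j). i < j \<and> j < 2 * n} - (\<lambda>i. (i, i + n)) ` {..<n}"
    by auto
  moreover have "(\<lambda>i. (i, i + n)) ` {..<n} \<subseteq> {(i, j). i < j \<and> j < 2 * n}"
    by auto
  moreover have "card ((\<lambda>i. (i, i + n)) ` {..<n}) = n"
    by (subst card_image) (auto simp: inj_on_def)
  ultimately have "card {(i, j). i < j \<and> j < 2 * n \<and> j \<noteq> i + n} = n * (2 * n - 1) - n"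
    using c fin by (simp add: card_Diff_subset finite_subset)
  also have "\<dots> = 2 * n * (n - 1)"
    by (cases n) (auto simp: algebra_simps)
  finally show ?thesis .
qed

text \<open>Injectivity of \<open>\<mu>\<close> lets each eigenvalue select exactly one Jordan
  block, so the outer multiset consists of n separate copies of \<open>{#1#}\<close>.\<close>

lemma type_of_semisimple_blocks:
  assumes "inj_on \<mu> {..<n}"
  shows "type_of_blocks (map (\<lambda>k. Jordan 1 (Finite_eigval (\<mu> k))) [0..<n] @
      replicate p (Horizontal 1) @ replicate q (Horizontal 2)) =
    \<lparr>jordan_sizes = replicate_mset n {#1#},
     horizontal_indices = replicate_mset p 1 + replicate_mset q 2,
     vertical_indices = {#}\<rparr>" (is "type_of_blocks ?bs = _")
proof -
  let ?J = "\<lambda>k. Jordan 1 (Finite_eigval (\<mu> k))"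
  have inj: "inj_on (\<lambda>k. Finite_eigval (\<mu> k)) {..<n}"
    using assms by (auto simp: inj_on_def)
  have ms: "mset ?bs = image_mset ?J (mset_set {..<n}) + replicate_mset p (Horizontal 1) +
      replicate_mset q (Horizontal 2)"
    by (simp add: mset_map[symmetric] del: mset_map) (simp add: lessThan_atLeast0)
  have ev: "block_eigval ` {b \<in> set ?bs. is_jordan b} = (\<lambda>k. Finite_eigval (\<mu> k)) ` {..<n}"
    by (auto intro!: image_eqI[where x = "?J k" for k])
  have rep: "filter_mset P (replicate_mset r x) = (if P x then replicate_mset r x else {#})" for P r and x :: kronecker_block
    by (induction r) auto
  have single: "image_mset index {# b \<in># mset ?bs. is_jordan b \<and> block_eigval b = Finite_eigval (\<mu> k) #} = {#1#}"
    if "k < n" for k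
  proof -
    have "{j \<in> {..<n}. \<mu> j = \<mu> k} = {k}"
      using assms that by (auto simp: inj_on_def)
    then show ?thesis
      unfolding ms by (simp add: filter_mset_image_mset rep)
  qed
  have "mset_set ((\<lambda>k. Finite_eigval (\<mu> k)) ` {..<n}) =
      image_mset (\<lambda>k. Finite_eigval (\<mu> k)) (mset_set {..<n})"
    using image_mset_mset_set[OF inj] by simp
  then have "jordan_sizes (type_of_blocks ?bs) = image_mset (\<lambda>_. {#1#}) (mset_set {..<n})"
    unfolding type_of_blocks_def ev algebraic_type.simps
    by (simp only: image_mset.compositionality o_def) (rule image_mset_cong, simp only: single finite_set_mset_mset_set finite_lessThan lessThan_iff)
  then have "jordan_sizes (type_of_blocks ?bs) = replicate_mset n {#1#}"
    by (simp add: image_mset_const_eq)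
  moreover have "horizontal_indices (type_of_blocks ?bs) = replicate_mset p 1 + replicate_mset q 2"
    "vertical_indices (type_of_blocks ?bs) = {#}"
    unfolding type_of_blocks_def ms by (simp_all add: filter_mset_image_mset rep)
  ultimately show ?thesis
    by simp
qed

section \<open>Values of the normal-form pencil on elementary matrices\<close>

lemma Lambda2_zero [simp]: "\<zero>\<^bsub>Lambda2 m\<^esub> = 0\<^sub>m m m"
  by (simp add: Lambda2_def module_mat_simps)

lemma wedge_mat_diag [simp]: "wedge_mat m (k, k) = 0\<^sub>m m m"
  by (auto simp: wedge_mat_def)

lemma skew_part_add:
  "X \<in> carrier_mat m m \<Longrightarrow> Y \<in> carrier_mat m m \<Longrightarrow>
    skew_part m l (X + Y) = skew_part m l X + skew_part m l Y"
  by (auto simp: skew_part_def algebra_simps intro!: eq_matI)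

lemma skew_part_smult:
  "X \<in> carrier_mat m m \<Longrightarrow> skew_part m l (c \<cdot>\<^sub>m X) = c \<cdot>\<^sub>m skew_part m l X"
  by (auto simp: skew_part_def algebra_simps intro!: eq_matI)

text \<open>Right multiplication by a diagonal matrix scales columns, so an elementary matrix picks
  up the factor of its column. This decouples the pencil: the span of E_ij and E_ji goes to the line
  of one wedge.\<close>

lemma skew_part_elem_mat: "skew_part m l (elem_mat m (i, j)) = l j \<cdot>\<^sub>m wedge_mat m (i, j)"
proof (rule eq_matI)
  fix r s assume "r < dim_row (l j \<cdot>\<^sub>m wedge_mat m (i, j))" "s < dim_col (l j \<cdot>\<^sub>m wedge_mat m (i, j))"
  then show "skew_part m l (elem_mat m (i, j)) $$ (r, s) = (l j \<cdot>\<^sub>m wedge_mat m (i, j)) $$ (r, s)"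
    by (cases "r = i"; cases "s = j"; cases "r = j"; cases "s = i")
      (simp_all add: skew_part_def wedge_mat_def elem_mat_def)
qed (simp_all add: skew_part_def)

lemma wedge_mat_swap: "wedge_mat m (j, i) = (- 1) \<cdot>\<^sub>m wedge_mat m (i, j)"
  by (auto simp: wedge_mat_def intro!: eq_matI)

text \<open>Inverts the change from E_ij, E_ji to the two source vectors of a width-2 block, with a
  and b the eigenvalues at i and j. The hypothesis on c is c = 1 / (a - b) written without
  division.\<close>

lemma smult_pair_recover:
  fixes a b c :: complex
  assumes c: "c * a = 1 + c * b" and carr: "X \<in> carrier_mat m m" "Y \<in> carrier_mat m m"
  shows "c \<cdot>\<^sub>m (a \<cdot>\<^sub>m X + b \<cdot>\<^sub>m Y) + b \<cdot>\<^sub>m ((- c) \<cdot>\<^sub>m (X + Y)) = X"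
    and "(- 1) \<cdot>\<^sub>m (c \<cdot>\<^sub>m (a \<cdot>\<^sub>m X + b \<cdot>\<^sub>m Y) + a \<cdot>\<^sub>m ((- c) \<cdot>\<^sub>m (X + Y))) = Y"
proof -
  have k: "c * (a * t) = t + c * (b * t)" for t
    using arg_cong[OF c, of "\<lambda>s. s * t"] by (simp add: algebra_simps)
  have "c * (a * x + b * y) + b * ((- c) * (x + y)) = x"
    "(- 1) * (c * (a * x + b * y) + a * ((- c) * (x + y))) = y" for x y
    using k[of x] k[of y] by (simp_all add: algebra_simps)
  note e = this[of "X $$ p" "Y $$ p" for p]
  show "c \<cdot>\<^sub>m (a \<cdot>\<^sub>m X + b \<cdot>\<^sub>m Y) + b \<cdot>\<^sub>m ((- c) \<cdot>\<^sub>m (X + Y)) = X"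
    by (rule eq_matI) (use carr in \<open>simp_all only: e index_add_mat index_smult_mat carrier_matD\<close>)
  show "(- 1) \<cdot>\<^sub>m (c \<cdot>\<^sub>m (a \<cdot>\<^sub>m X + b \<cdot>\<^sub>m Y) + a \<cdot>\<^sub>m ((- c) \<cdot>\<^sub>m (X + Y))) = Y"
    by (rule eq_matI) (use carr in \<open>simp_all only: e index_add_mat index_smult_mat carrier_matD\<close>)
qed

text \<open>The four values of the pencil on the source vectors of a width-2 block, where W is the
  wedge, E_ij has value W scaled by its column factor, and E_ji has value -W scaled likewise. The
  factors 0 and 1 are kept on the right since they are the entries of the block matrices.\<close>

lemma smult_pair_cancel:
  fixes a b c :: complex
  assumes c: "c * a = 1 + c * b" and W: "W \<in> carrier_mat m m"
  shows "c \<cdot>\<^sub>m (a \<cdot>\<^sub>m (b \<cdot>\<^sub>m W) + b \<cdot>\<^sub>m (a \<cdot>\<^sub>m ((- 1) \<cdot>\<^sub>m W))) = 0 \<cdot>\<^sub>m W"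
    and "(- c) \<cdot>\<^sub>m (b \<cdot>\<^sub>m W + a \<cdot>\<^sub>m ((- 1) \<cdot>\<^sub>m W)) = 1 \<cdot>\<^sub>m W"
    and "c \<cdot>\<^sub>m (a \<cdot>\<^sub>m (1 \<cdot>\<^sub>m W) + b \<cdot>\<^sub>m (1 \<cdot>\<^sub>m ((- 1) \<cdot>\<^sub>m W))) = 1 \<cdot>\<^sub>m W"
    and "(- c) \<cdot>\<^sub>m (1 \<cdot>\<^sub>m W + 1 \<cdot>\<^sub>m ((- 1) \<cdot>\<^sub>m W)) = 0 \<cdot>\<^sub>m W"
proof -
  have k: "c * (a * t) = t + c * (b * t)" for t
    using arg_cong[OF c, of "\<lambda>s. s * t"] by (simp add: algebra_simps)
  have e: "c * (a * (b * w) + b * (a * ((- 1) * w))) = 0 * w"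
    "(- c) * (b * w + a * ((- 1) * w)) = 1 * w"
    "c * (a * (1 * w) + b * (1 * ((- 1) * w))) = 1 * w"
    "(- c) * (1 * w + 1 * ((- 1) * w)) = 0 * w" for w
    using k[of w] by (simp_all add: algebra_simps)
  show "c \<cdot>\<^sub>m (a \<cdot>\<^sub>m (b \<cdot>\<^sub>m W) + b \<cdot>\<^sub>m (a \<cdot>\<^sub>m ((- 1) \<cdot>\<^sub>m W))) = 0 \<cdot>\<^sub>m W"
    "(- c) \<cdot>\<^sub>m (b \<cdot>\<^sub>m W + a \<cdot>\<^sub>m ((- 1) \<cdot>\<^sub>m W)) = 1 \<cdot>\<^sub>m W"
    "c \<cdot>\<^sub>m (a \<cdot>\<^sub>m (1 \<cdot>\<^sub>m W) + b \<cdot>\<^sub>m (1 \<cdot>\<^sub>m ((- 1) \<cdot>\<^sub>m W))) = 1 \<cdot>\<^sub>m W"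
    "(- c) \<cdot>\<^sub>m (1 \<cdot>\<^sub>m W + 1 \<cdot>\<^sub>m ((- 1) \<cdot>\<^sub>m W)) = 0 \<cdot>\<^sub>m W"
    by (rule eq_matI; use W in \<open>simp only: e index_add_mat index_smult_mat carrier_matD\<close>)+
qed

text \<open>On x E_ij + y E_ji the two maps have the wedge coefficients x l_j - y l_i and x - y. For
  l_i \<noteq> l_j these forms are independent, and a change of basis makes them a horizontal block
  of width 2. For l_i = l_j they are proportional and give a Jordan block of size 1 and a zero
  column. Each E_ii is one more zero column, whence 2n + n of them.\<close>

lemma has_algebraic_type_skew_part:
  assumes "inj_on \<mu> {..<n}"
  shows "has_algebraic_type (gl (2 * n)) (Lambda2 (2 * n))
    (skew_part (2 * n) (\<lambda>i. \<mu> (i mod n))) (skew_part (2 * n) (\<lambda>_. 1))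
    \<lparr>jordan_sizes = replicate_mset n {#1#},
     horizontal_indices = replicate_mset (3 * n) 1 + replicate_mset (2 * n * (n - 1)) 2,
     vertical_indices = {#}\<rparr>"
proof -
  define m l A B where "m = 2 * n" and "l i = \<mu> (i mod n)"
    and "A = skew_part m l" and "B = skew_part m (\<lambda>_. 1)" for i
  interpret V: vectorspace class_ring "gl m" by (rule matrix_vs)
  define NP where "NP = filter (\<lambda>(i, j). i < j \<and> j \<noteq> i + n) (List.product [0..<m] [0..<m])"
  have NP: "distinct NP" "set NP = {(i, j). i < j \<and> j < m \<and> j \<noteq> i + n}"
    by (auto simp: NP_def distinct_product)
  have len_NP: "length NP = 2 * n * (n - 1)"
    using distinct_card[OF NP(1)] card_less_pairs[of n] by (simp add: NP(2) m_def)
  \<comment> \<open>A residue class modulo n has just two members below 2n, and they differ by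
    n.\<close>
  have l_neq: "l i \<noteq> l j" if "(i, j) \<in> set NP" for i j
  proof
    have ij: "i < j" "j < 2 * n" "j \<noteq> i + n"
      using that by (auto simp: NP(2) m_def)
    then have n: "0 < n" by simp
    assume "l i = l j"
    then have "i mod n = j mod n"
      using assms n by (auto simp: l_def inj_on_def)
    moreover define a b r where "a = i div n" and "b = j div n" and "r = j mod n"
    ultimately have eq: "i = n * a + r" "j = n * b + r"
      by (metis mult_div_mod_eq)+
    have "a < 2" "b < 2"
      using ij n by (simp_all add: a_def b_def less_mult_imp_div_less)
    then consider "a = b" | "a = 0" "b = 1" | "a = 1" "b = 0"
      by linarith
    then show False
    proof cases
      case 1
      then have "i = j" using eq by simp
      then show False using ij by simp
    next
      case 2
      then have "j = i + n" using eq by simp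
      then show False using ij by simp
    next
      case 3
      then have "j < i" using eq n by simp
      then show False using ij by simp
    qed
  qed
  \<comment> \<open>\<open>A\<close> kills \<open>u0\<close>, \<open>B\<close> kills \<open>u1\<close>, and \<open>B u0 = A u1\<close> is the wedge: a horizontal block of width 2.\<close>
  define u0 where "u0 p = (case p of (i, j) \<Rightarrow>
    (1 / (l i - l j)) \<cdot>\<^sub>m (l i \<cdot>\<^sub>m elem_mat m (i, j) + l j \<cdot>\<^sub>m elem_mat m (j, i)))" for p
  define u1 where "u1 p = (case p of (i, j) \<Rightarrow>
    (- 1 / (l i - l j)) \<cdot>\<^sub>m (elem_mat m (i, j) + elem_mat m (j, i)))" for p
  \<comment> \<open>Every entry holds a block, its source vectors and its target vectors, so that
    the block list and both bases, read off from \<open>D\<close>, are aligned.\<close>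
  define D where "D = map (\<lambda>k. (Jordan 1 (Finite_eigval (\<mu> k)), [elem_mat m (k, k + n)], [wedge_mat m (k, k + n)])) [0..<n]
    @ map (\<lambda>k. (Horizontal 1, [elem_mat m (k, k)], [])) [0..<2 * n]
    @ map (\<lambda>k. (Horizontal 1, [elem_mat m (k, k + n) + elem_mat m (k + n, k)], [])) [0..<n]
    @ map (\<lambda>p. (Horizontal 2, [u0 p, u1 p], [wedge_mat m p])) NP"
  define bs us vs where "bs = map fst D" and "us = concat (map (fst \<circ> snd) D)" and "vs = concat (map (snd \<circ> snd) D)"
  have bs: "bs = map (\<lambda>k. Jordan 1 (Finite_eigval (\<mu> k))) [0..<n] @
      replicate (3 * n) (Horizontal 1) @ replicate (2 * n * (n - 1)) (Horizontal 2)"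
  proof -
    have "replicate (3 * n) (Horizontal 1) = replicate (2 * n) (Horizontal 1) @ replicate n (Horizontal 1)"
      by (simp add: replicate_add[symmetric])
    then show ?thesis
      by (simp add: bs_def D_def o_def map_replicate_const len_NP del: One_nat_def)
  qed
  have us: "us = map (\<lambda>k. elem_mat m (k, k + n)) [0..<n] @ map (\<lambda>k. elem_mat m (k, k)) [0..<2 * n]
      @ map (\<lambda>k. elem_mat m (k, k + n) + elem_mat m (k + n, k)) [0..<n] @ concat (map (\<lambda>p. [u0 p, u1 p]) NP)"
    by (simp add: us_def D_def o_def)
  have vs: "vs = map (wedge_mat m) (map (\<lambda>k. (k, k + n)) [0..<n] @ NP)"
    by (simp add: vs_def D_def o_def)
  have "ordered_basis (Lambda2 m) vs"
    unfolding vs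
  proof (rule ordered_basis_wedge_mat)
    show "distinct (map (\<lambda>k. (k, k + n)) [0..<n] @ NP)"
      by (auto simp: NP distinct_map inj_on_def)
    show "set (map (\<lambda>k. (k, k + n)) [0..<n] @ NP) = {(i, j). i < j \<and> j < m}"
      by (auto simp: NP m_def)
  qed
  moreover have "ordered_basis (gl m) us"
  \<comment> \<open>The length is n + 2n + n + 4n(n - 1) = (2n)^2, so it remains to recover every
    elementary matrix in the span.\<close>
  proof (rule ordered_basis_spanning[OF matrix_vs ordered_basis_elem_mat])
    show carr: "set us \<subseteq> carrier (gl m)"
      by (auto simp: us module_mat_simps u0_def u1_def)
    have "length (concat (map (\<lambda>p. [u0 p, u1 p]) xs)) = 2 * length xs" for xs
      by (induction xs) auto
    then have "length us = 4 * n + 4 * (n * (n - 1))"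
      by (simp add: us len_NP)
    also have "\<dots> = m * m"
      by (cases n) (auto simp: m_def algebra_simps)
    finally show "length us \<le> length (map (elem_mat m) (List.product [0..<m] [0..<m]))"
      by simp
    interpret S: submodule class_ring "V.span (set us)" "gl m"
      by (rule V.span_is_submodule[OF carr])
    have in_S: "u \<in> V.span (set us)" if "u \<in> set us" for u
      using V.in_own_span[OF carr] that by blast
    have add_S: "x + y \<in> V.span (set us)" if "x \<in> V.span (set us)" "y \<in> V.span (set us)" for x y
      using S.m_closed[OF that] by (simp add: module_mat_simps)
    have smult_S: "c \<cdot>\<^sub>m x \<in> V.span (set us)" if "x \<in> V.span (set us)" for c x
      using S.smult_closed[OF _ that, of c] by (simp add: module_mat_simps class_ring_simps)
    have diag: "elem_mat m (k, k) \<in> V.span (set us)" if "k < m" for k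
      using that by (intro in_S) (auto simp: us m_def)
    have partner: "elem_mat m (k, k + n) \<in> V.span (set us)" "elem_mat m (k + n, k) \<in> V.span (set us)"
      if k: "k < n" for k
    proof -
      show 1: "elem_mat m (k, k + n) \<in> V.span (set us)"
        using k by (intro in_S) (auto simp: us)
      have 2: "elem_mat m (k, k + n) + elem_mat m (k + n, k) \<in> V.span (set us)"
        using k by (intro in_S) (auto simp: us)
      have "elem_mat m (k + n, k) = (elem_mat m (k, k + n) + elem_mat m (k + n, k)) + (- 1) \<cdot>\<^sub>m elem_mat m (k, k + n)"
        by (intro eq_matI) auto
      with add_S[OF 2 smult_S[OF 1]] show "elem_mat m (k + n, k) \<in> V.span (set us)"
        by metis
    qed
    have other: "elem_mat m (i, j) \<in> V.span (set us) \<and> elem_mat m (j, i) \<in> V.span (set us)"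
      if p: "(i, j) \<in> set NP" for i j
    proof -
      have "u0 (i, j) \<in> set us" "u1 (i, j) \<in> set us"
        using p by (auto simp: us)
      note 0 = this[THEN in_S]
      define c where "c = 1 / (l i - l j)"
      have c: "c * l i = 1 + c * l j"
        using l_neq[OF p] by (simp add: c_def field_simps)
      have u: "u0 (i, j) = c \<cdot>\<^sub>m (l i \<cdot>\<^sub>m elem_mat m (i, j) + l j \<cdot>\<^sub>m elem_mat m (j, i))"
        "u1 (i, j) = (- c) \<cdot>\<^sub>m (elem_mat m (i, j) + elem_mat m (j, i))"
        by (simp_all add: u0_def u1_def c_def)
      have "elem_mat m (i, j) = u0 (i, j) + l j \<cdot>\<^sub>m u1 (i, j)"
        "elem_mat m (j, i) = (- 1) \<cdot>\<^sub>m (u0 (i, j) + l i \<cdot>\<^sub>m u1 (i, j))"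
        unfolding u using smult_pair_recover[OF c, of "elem_mat m (i, j)" m "elem_mat m (j, i)"] by simp_all
      then show ?thesis
        by (auto intro!: add_S smult_S 0)
    qed
    show "set (map (elem_mat m) (List.product [0..<m] [0..<m])) \<subseteq> V.span (set us)"
    proof (clarsimp)
      fix i j assume ij: "i < m" "j < m"
      consider "i = j" | "j = i + n" | "i = j + n" | "(i, j) \<in> set NP" | "(j, i) \<in> set NP"
        using ij linorder_less_linear[of i j] by (auto simp: NP)
      then show "elem_mat m (i, j) \<in> V.span (set us)"
        using ij diag partner other by cases (auto simp: m_def)
    qed
  qed
  moreover have "represents (Lambda2 m) us vs A (diag_block_mat (map block_A bs)) \<and>
      represents (Lambda2 m) us vs B (diag_block_mat (map block_B bs))"
  proof -
    have carr: "set ((snd \<circ> snd) t) \<subseteq> carrier (Lambda2 m)" if "t \<in> set D" for t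
      using that by (auto simp: D_def)
    note single = represents_single[OF Lambda2_vectorspace, unfolded Lambda2_simps, OF wedge_mat_skew]
    note null = represents_Nil_zero[OF Lambda2_vectorspace, unfolded Lambda2_zero]
    have "represents (Lambda2 m) ((fst \<circ> snd) t) ((snd \<circ> snd) t) A ((block_A \<circ> fst) t) \<and>
      represents (Lambda2 m) ((fst \<circ> snd) t) ((snd \<circ> snd) t) B ((block_B \<circ> fst) t)" if "t \<in> set D" for t
    proof -
      consider k where "k < n" "t = (Jordan 1 (Finite_eigval (\<mu> k)), [elem_mat m (k, k + n)], [wedge_mat m (k, k + n)])"
        | k where "k < 2 * n" "t = (Horizontal 1, [elem_mat m (k, k)], [])"
        | k where "k < n" "t = (Horizontal 1, [elem_mat m (k, k + n) + elem_mat m (k + n, k)], [])"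
        | i j where "(i, j) \<in> set NP" "t = (Horizontal 2, [u0 (i, j), u1 (i, j)], [wedge_mat m (i, j)])"
        using \<open>t \<in> set D\<close> unfolding D_def by auto
      then show ?thesis
      proof cases
        case 1
        then have "l k = \<mu> k" "l (k + n) = \<mu> k"
          by (simp_all add: l_def)
        then show ?thesis
          by (simp add: 1(2) single A_def B_def jordan_block_def skew_part_elem_mat)
      next
        case 2
        \<comment> \<open>An arbitrary \<open>l'\<close> covers both maps at once: \<open>l\<close>
          for \<open>A\<close> and the constant 1 for \<open>B\<close>.\<close>
        have "skew_part m l' (elem_mat m (k, k)) = 0\<^sub>m m m" for l'
          by (simp add: skew_part_elem_mat)
        then show ?thesis
          by (simp add: 2(2) null A_def B_def shift_right_def shift_left_def)
      next
        case 3
        have "skew_part m l' (elem_mat m (k, k + n) + elem_mat m (k + n, k)) = 0\<^sub>m m m"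
          if "l' k = l' (k + n)" for l'
          by (simp add: skew_part_add skew_part_elem_mat wedge_mat_swap[of m "k + n"] that)
            (rule eq_matI; simp)
        moreover have "l k = l (k + n)"
          by (simp add: l_def)
        ultimately show ?thesis
          by (simp add: 3(2) null A_def B_def shift_right_def shift_left_def)
      next
        case 4
        define c where "c = 1 / (l i - l j)"
        have c: "c * l i = 1 + c * l j"
          using l_neq[OF 4(1)] by (simp add: c_def field_simps)
        have u: "u0 (i, j) = c \<cdot>\<^sub>m (l i \<cdot>\<^sub>m elem_mat m (i, j) + l j \<cdot>\<^sub>m elem_mat m (j, i))"
          "u1 (i, j) = (- c) \<cdot>\<^sub>m (elem_mat m (i, j) + elem_mat m (j, i))"
          by (simp_all add: u0_def u1_def c_def)
        have "A (u0 (i, j)) = 0 \<cdot>\<^sub>m wedge_mat m (i, j)" "B (u1 (i, j)) = 0 \<cdot>\<^sub>m wedge_mat m (i, j)"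
          "A (u1 (i, j)) = 1 \<cdot>\<^sub>m wedge_mat m (i, j)" "B (u0 (i, j)) = 1 \<cdot>\<^sub>m wedge_mat m (i, j)"
          unfolding A_def B_def u
          using smult_pair_cancel[OF c, of "wedge_mat m (i, j)" m]
          by (simp_all add: skew_part_add skew_part_smult skew_part_elem_mat wedge_mat_swap[of m j i])
        then show ?thesis
          by (simp add: 4(2) single All_less_Suc numeral_2_eq_2 shift_right_def shift_left_def)
      qed
    qed
    then show ?thesis
      unfolding us_def vs_def bs_def map_map
      using represents_diag_block_mat[where us = "fst \<circ> snd" and vs = "snd \<circ> snd", OF Lambda2_vectorspace carr]
      by blast
  qed
  moreover have "\<forall>b \<in> set bs. index b \<ge> 1"
    by (auto simp: bs)
  ultimately have "kronecker_form (gl m) (Lambda2 m) A B bs"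
    unfolding kronecker_form_def by blast
  then show ?thesis
    using type_of_semisimple_blocks[OF assms, of "3 * n" "2 * n * (n - 1)", folded bs]
    unfolding has_algebraic_type_def m_def A_def B_def l_def by blast
qed

section \<open>Kernels of skew-symmetric matrices and power sums\<close>

lemma det_skew_odd:
  assumes "C \<in> skew_mats m" "odd m"
  shows "det C = 0"
proof -
  have C: "C \<in> carrier_mat m m" "transpose_mat C = (- 1) \<cdot>\<^sub>m C"
    using assms(1) by (auto simp: skew_mats_def)
  have "det C = det ((- 1) \<cdot>\<^sub>m C)"
    using det_transpose[OF C(1)] C(2) by simp
  also have "\<dots> = - det C"
    using C(1) assms(2) by (simp add: det_smult)
  finally show ?thesis
    by simp
qed

lemma mult_mat_vec_index_sum:
  "A \<in> carrier_mat r c \<Longrightarrow> v \<in> carrier_vec c \<Longrightarrow> i < r \<Longrightarrow>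
    (A *\<^sub>v v) $ i = (\<Sum>j<c. A $$ (i, j) * v $ j)"
  by (auto simp: scalar_prod_def lessThan_atLeast0)

text \<open>The rank of a skew matrix is even, so its kernel in even dimension cannot be a line. In
  place of ranks, the proof takes a kernel vector x of a bordered matrix of odd size and shows that
  its last coordinate vanishes. The conditions \<open>v $ k \<noteq> 0\<close> and
  \<open>w $ k = 0\<close> express that v and w are independent in the form in which this is used
  later.\<close>

lemma skew_kernel_second:
  assumes C: "C \<in> skew_mats m" and m: "even m"
    and v: "v \<in> carrier_vec m" "C *\<^sub>v v = 0\<^sub>v m" and k: "k < m" "v $ k \<noteq> 0"
  obtains w where "w \<in> carrier_vec m" "w \<noteq> 0\<^sub>v m" "C *\<^sub>v w = 0\<^sub>v m" "w $ k = 0"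
proof -
  have Cc: "C \<in> carrier_mat m m"
    using C by (simp add: skew_mats_def)
  \<comment> \<open>The bordered matrix with blocks \<open>C\<close>, \<open>e\<^sub>k\<close>, \<open>- e\<^sub>k\<^sup>T\<close>, \<open>0\<close> is skew-symmetric of odd size.\<close>
  define B where "B = mat (Suc m) (Suc m) (\<lambda>(i, j).
    if i < m then (if j < m then C $$ (i, j) else if i = k then 1 else 0)
    else if j = k then - 1 else 0)"
  have B: "B \<in> carrier_mat (Suc m) (Suc m)"
    by (simp add: B_def)
  have "transpose_mat B = - B"
  proof (rule eq_matI)
    fix i j assume "i < dim_row (- B)" "j < dim_col (- B)"
    then have "i < Suc m" "j < Suc m"
      by (simp_all add: B_def)
    then show "transpose_mat B $$ (i, j) = (- B) $$ (i, j)"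
      using skew_mats_swap[OF C, of i j] k(1) by (auto simp: B_def less_Suc_eq)
  qed (simp_all add: B_def)
  then have "det B = 0"
    using B m by (intro det_skew_odd[of _ "Suc m"]) (simp_all add: skew_mats_def)
  then obtain x where x: "x \<in> carrier_vec (Suc m)" "x \<noteq> 0\<^sub>v (Suc m)" "B *\<^sub>v x = 0\<^sub>v (Suc m)"
    using det_0_iff_vec_prod_zero[OF B] by blast
  have Bx: "(\<Sum>j<Suc m. B $$ (i, j) * x $ j) = 0" if "i < Suc m" for i
    using mult_mat_vec_index_sum[OF B x(1) that] x(3) that by simp
  have row: "(\<Sum>j<m. C $$ (i, j) * x $ j) + (if i = k then x $ m else 0) = 0" if "i < m" for i
  proof -
    have "(\<Sum>j<m. B $$ (i, j) * x $ j) = (\<Sum>j<m. C $$ (i, j) * x $ j)"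
      using that by (intro sum.cong) (auto simp: B_def)
    moreover have "B $$ (i, m) = (if i = k then 1 else 0)"
      using that by (simp add: B_def)
    ultimately show ?thesis
      using Bx[of i] that by auto
  qed
  have xk: "x $ k = 0"
  proof -
    have "(\<Sum>j<m. B $$ (m, j) * x $ j) = (\<Sum>j<m. if j = k then - x $ k else 0)"
      by (intro sum.cong) (auto simp: B_def)
    moreover have "B $$ (m, m) = 0"
      using k by (simp add: B_def)
    ultimately show ?thesis
      using Bx[of m] k by simp
  qed
  have left: "(\<Sum>i<m. v $ i * C $$ (i, j)) = 0" if "j < m" for j
  proof -
    have "(\<Sum>i<m. v $ i * C $$ (i, j)) = (\<Sum>i<m. - (C $$ (j, i) * v $ i))"
      using skew_mats_swap[OF C that] by (intro sum.cong) auto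
    also have "\<dots> = - ((C *\<^sub>v v) $ j)"
      using that by (simp add: mult_mat_vec_index_sum[OF Cc v(1)] sum_negf)
    finally show ?thesis
      using v that by simp
  qed
  \<comment> \<open>Pair v with the first m rows of B x = 0: the part with C dies because v^T C = 0,
    and only v_k x_m remains.\<close>
  have "0 = (\<Sum>i<m. v $ i * ((\<Sum>j<m. C $$ (i, j) * x $ j) + (if i = k then x $ m else 0)))"
    using row by simp
  also have "\<dots> = (\<Sum>i<m. \<Sum>j<m. v $ i * C $$ (i, j) * x $ j) + (\<Sum>i<m. if i = k then v $ k * x $ m else 0)"
    unfolding sum.distrib[symmetric]
    by (intro sum.cong) (auto simp: distrib_left sum_distrib_left mult.assoc)
  also have "\<dots> = (\<Sum>j<m. (\<Sum>i<m. v $ i * C $$ (i, j)) * x $ j) + v $ k * x $ m"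
    using k by (subst sum.swap) (simp add: sum_distrib_right)
  also have "\<dots> = v $ k * x $ m"
    using left by simp
  finally have xm: "x $ m = 0"
    using k by simp
  define w where "w = vec m (($) x)"
  show thesis
  proof
    show w: "w \<in> carrier_vec m"
      by (simp add: w_def)
    show "w $ k = 0"
      using k xk by (simp add: w_def)
    show "C *\<^sub>v w = 0\<^sub>v m"
    proof (rule eq_vecI)
      fix i assume "i < dim_vec (0\<^sub>v m :: complex vec)"
      then have i: "i < m" by simp
      have "(\<Sum>j<m. C $$ (i, j) * w $ j) = (\<Sum>j<m. C $$ (i, j) * x $ j)"
        by (simp add: w_def)
      then show "(C *\<^sub>v w) $ i = (0\<^sub>v m) $ i"
        using row[OF i] xm i by (simp only: mult_mat_vec_index_sum[OF Cc w i]) simp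
    qed (use Cc in simp)
    show "w \<noteq> 0\<^sub>v m"
    proof
      assume "w = 0\<^sub>v m"
      then have "x $ i = 0" if "i < m" for i
        using that by (metis w_def index_vec index_zero_vec(1))
      then have "x = 0\<^sub>v (Suc m)"
        using x(1) xm by (intro eq_vecI) (auto simp: less_Suc_eq)
      with x(2) show False by simp
    qed
  qed
qed

section \<open>Traces of powers and the number of distinct eigenvalues\<close>

text \<open>The relations for monomials extend linearly to all polynomials of degree below n. The
  Lagrange polynomial that vanishes at every node except the k-th has degree n - 1 and isolates
  c_k.\<close>

lemma vandermonde_kernel_trivial:
  fixes \<mu> c :: "nat \<Rightarrow> 'a :: idom"
  assumes inj: "inj_on \<mu> {..<n}" and eq: "\<And>j. j < n \<Longrightarrow> (\<Sum>k<n. \<mu> k ^ j * c k) = 0" and k: "k < n"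
  shows "c k = 0"
proof -
  have poly: "(\<Sum>k<n. poly q (\<mu> k) * c k) = 0" if "degree q < n" for q
  proof -
    have "(\<Sum>k<n. poly q (\<mu> k) * c k) = (\<Sum>k<n. \<Sum>j\<le>degree q. coeff q j * (\<mu> k ^ j * c k))"
      by (simp add: poly_altdef sum_distrib_right mult.assoc)
    also have "\<dots> = (\<Sum>j\<le>degree q. coeff q j * (\<Sum>k<n. \<mu> k ^ j * c k))"
      by (subst sum.swap) (simp add: sum_distrib_left)
    also have "\<dots> = 0"
      using that eq by simp
    finally show ?thesis .
  qed
  define q where "q = (\<Prod>i\<in>{..<n} - {k}. [:- \<mu> i, 1:])"
  have "degree q = (\<Sum>i\<in>{..<n} - {k}. degree [:- \<mu> i, 1:])"
    unfolding q_def by (rule degree_prod_eq_sum_degree) simp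
  then have "degree q < n"
    using k by simp
  then have "0 = (\<Sum>i<n. poly q (\<mu> i) * c i)"
    using poly by simp
  also have "\<dots> = (\<Sum>i<n. if i = k then poly q (\<mu> k) * c k else 0)"
    by (intro sum.cong) (auto simp: q_def poly_prod)
  also have "\<dots> = poly q (\<mu> k) * c k"
    using k by simp
  finally have "poly q (\<mu> k) * c k = 0" ..
  moreover have "poly q (\<mu> k) \<noteq> 0"
    using inj k by (auto simp: q_def poly_prod inj_on_def)
  ultimately show ?thesis by simp
qed

definition trace_mat :: "'a :: comm_monoid_add mat \<Rightarrow> 'a" where
  "trace_mat A = (\<Sum>i<dim_row A. A $$ (i, i))"

lemma trace_mat_mult_comm:
  fixes A B :: "'a :: comm_semiring_0 mat"
  assumes "A \<in> carrier_mat r c" "B \<in> carrier_mat c r"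
  shows "trace_mat (A * B) = trace_mat (B * A)"
proof -
  have "trace_mat (A * B) = (\<Sum>i<r. \<Sum>j<c. A $$ (i, j) * B $$ (j, i))"
    using assms by (auto simp: trace_mat_def scalar_prod_def lessThan_atLeast0 intro!: sum.cong)
  also have "\<dots> = (\<Sum>j<c. \<Sum>i<r. B $$ (j, i) * A $$ (i, j))"
    by (subst sum.swap) (simp add: mult.commute)
  also have "\<dots> = trace_mat (B * A)"
    using assms by (auto simp: trace_mat_def scalar_prod_def lessThan_atLeast0 intro!: sum.cong)
  finally show ?thesis .
qed

lemma upper_triangular_mult:
  fixes A B :: "'a :: comm_semiring_1 mat"
  assumes A: "A \<in> carrier_mat n n" "upper_triangular A" and B: "B \<in> carrier_mat n n" "upper_triangular B"
  shows "upper_triangular (A * B)"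
    and "i < n \<Longrightarrow> (A * B) $$ (i, i) = A $$ (i, i) * B $$ (i, i)"
proof -
  have entry: "(A * B) $$ (i, j) = (\<Sum>k<n. A $$ (i, k) * B $$ (k, j))" if "i < n" "j < n" for i j
    using that A(1) B(1) by (auto simp: scalar_prod_def lessThan_atLeast0)
  have zero: "A $$ (i, k) * B $$ (k, j) = 0" if "i < n" "k < n" "k < i \<or> j < k" for i j k
    using that A B upper_triangularD[OF A(2), of k i] upper_triangularD[OF B(2), of j k] by auto
  show "upper_triangular (A * B)"
  proof (rule upper_triangularI)
    fix i j assume "j < i" "i < dim_row (A * B)"
    then have ij: "i < n" "j < n" "j < i" using A(1) by auto
    then have "\<And>k. k < n \<Longrightarrow> A $$ (i, k) * B $$ (k, j) = 0"
      using zero by (metis linorder_le_less_linear order_le_less_trans less_le_trans)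
    then show "(A * B) $$ (i, j) = 0"
      using ij by (simp add: entry)
  qed
  show "(A * B) $$ (i, i) = A $$ (i, i) * B $$ (i, i)" if i: "i < n"
  proof -
    have "(\<Sum>k<n. A $$ (i, k) * B $$ (k, i)) = (\<Sum>k<n. if k = i then A $$ (i, i) * B $$ (i, i) else 0)"
      using zero[OF i] by (intro sum.cong) (auto simp: linorder_neq_iff)
    then show ?thesis
      using i by (simp add: entry)
  qed
qed

lemma upper_triangular_pow:
  fixes A :: "'a :: comm_semiring_1 mat"
  assumes A: "A \<in> carrier_mat n n" "upper_triangular A"
  shows "upper_triangular (A ^\<^sub>m k)" and "i < n \<Longrightarrow> (A ^\<^sub>m k) $$ (i, i) = (A $$ (i, i)) ^ k"
proof -
  have "upper_triangular (A ^\<^sub>m k) \<and> (\<forall>i<n. (A ^\<^sub>m k) $$ (i, i) = (A $$ (i, i)) ^ k)"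
  proof (induction k)
    case 0
    then show ?case using A(1) by auto
  next
    case (Suc k)
    then show ?case
      using upper_triangular_mult[OF pow_carrier_mat[OF A(1), of k] _ A] by (simp add: mult.commute)
  qed
  then show "upper_triangular (A ^\<^sub>m k)" "i < n \<Longrightarrow> (A ^\<^sub>m k) $$ (i, i) = (A $$ (i, i)) ^ k"
    by simp_all
qed

text \<open>Schur triangularization: powers of a triangular matrix have the powers on the diagonal,
  and similarity preserves the trace. One sequence \<open>e\<close> of diagonal entries serves all
  exponents.\<close>

lemma trace_mat_pow:
  fixes N :: "complex mat"
  assumes N: "N \<in> carrier_mat m m"
  obtains e where "\<And>k. trace_mat (N ^\<^sub>m k) = (\<Sum>i<m. e i ^ k)" "\<And>i. i < m \<Longrightarrow> eigenvalue N (e i)"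
proof -
  obtain es where "char_poly N = (\<Prod>a\<leftarrow>es. [:- a, 1:])"
    using char_poly_factorized[OF N] by blast
  then obtain B where B: "B \<in> carrier_mat m m" "upper_triangular B" "similar_mat N B"
    using schur_decomposition_exists[OF N] by blast
  then obtain P Q where wit: "similar_mat_wit N B P Q"
    by (auto simp: similar_mat_def)
  then have PQ: "P \<in> carrier_mat m m" "Q \<in> carrier_mat m m" "Q * P = 1\<^sub>m m"
    using N by (auto simp: similar_mat_wit_def Let_def)
  show thesis
  proof
    show "trace_mat (N ^\<^sub>m k) = (\<Sum>i<m. (B $$ (i, i)) ^ k)" for k
    proof -
      have Bk: "B ^\<^sub>m k \<in> carrier_mat m m"
        using B(1) by (rule pow_carrier_mat)
      have "trace_mat (N ^\<^sub>m k) = trace_mat (P * (B ^\<^sub>m k * Q))"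
        using similar_mat_wit_pow_id[OF wit, of k] assoc_mult_mat[OF PQ(1) Bk PQ(2)] by simp
      also have "\<dots> = trace_mat (B ^\<^sub>m k * Q * P)"
        using PQ Bk by (intro trace_mat_mult_comm[of _ m m]) auto
      also have "B ^\<^sub>m k * Q * P = B ^\<^sub>m k"
        using assoc_mult_mat[OF Bk PQ(2,1)] PQ(3) right_mult_one_mat[OF Bk] by simp
      also have "trace_mat (B ^\<^sub>m k) = (\<Sum>i<m. (B $$ (i, i)) ^ k)"
        using B(1) upper_triangular_pow(2)[OF B(1,2)] by (simp add: trace_mat_def)
      finally show ?thesis .
    qed
    show "eigenvalue N (B $$ (i, i))" if "i < m" for i
    proof -
      have "B $$ (i, i) \<in> set (diag_mat B)"
        using that B(1) by (auto simp: diag_mat_def)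
      then have "poly (char_poly B) (B $$ (i, i)) = 0"
        unfolding char_poly_upper_triangular[OF B(1,2)] by (induction "diag_mat B") (auto simp: poly_prod_list prod_list_zero_iff)
      then show ?thesis
        using char_poly_similar[OF B(3)] by (simp add: eigenvalue_root_char_poly[OF N])
    qed
  qed
qed

text \<open>The matrix is the Gram matrix of the trace form (p, q) |-> tr(p(N) q(N)) on polynomials
  of degree below n. With fewer than n eigenvalues, some nonzero polynomial of such degree vanishes
  at all of them and lies in the radical.\<close>

lemma power_sum_det_distinct_eigenvalues:
  fixes N :: "complex mat"
  assumes N: "N \<in> carrier_mat m m"
    and det: "det (mat n n (\<lambda>(i, j). trace_mat (N ^\<^sub>m (i + j)))) \<noteq> 0"
  obtains \<mu> where "inj_on \<mu> {..<n}" "\<And>k. k < n \<Longrightarrow> eigenvalue N (\<mu> k)"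
proof -
  obtain e where e: "\<And>k. trace_mat (N ^\<^sub>m k) = (\<Sum>i<m. e i ^ k)" "\<And>i. i < m \<Longrightarrow> eigenvalue N (e i)"
    using trace_mat_pow[OF N] by blast
  let ?E = "e ` {..<m}"
  let ?G = "mat n n (\<lambda>(i, j). trace_mat (N ^\<^sub>m (i + j)))"
  have "n \<le> card ?E"
  proof (rule ccontr)
    assume "\<not> n \<le> card ?E"
    \<comment> \<open>The coefficients of the polynomial with simple roots at the eigenvalues lie in the kernel.\<close>
    define q where "q = (\<Prod>a\<in>?E. [:- a, 1:])"
    have "degree q = (\<Sum>a\<in>?E. degree [:- a, 1:])"
      unfolding q_def by (rule degree_prod_eq_sum_degree) simp
    then have deg: "degree q < n"
      using \<open>\<not> n \<le> card ?E\<close> by simp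
    have q0: "q \<noteq> 0"
      by (simp add: q_def)
    define c where "c = vec n (coeff q)"
    have pq: "poly q x = (\<Sum>j<n. coeff q j * x ^ j)" for x
    proof -
      have "poly q x = (\<Sum>j\<le>degree q. coeff q j * x ^ j)"
        by (rule poly_altdef)
      also have "\<dots> = (\<Sum>j<n. coeff q j * x ^ j)"
        using deg by (intro sum.mono_neutral_left) (auto simp: coeff_eq_0)
      finally show ?thesis .
    qed
    have root: "poly q (e k) = 0" if "k < m" for k
      using that by (auto simp: q_def poly_prod)
    have "?G *\<^sub>v c = 0\<^sub>v n"
    proof (rule eq_vecI)
      fix i assume "i < dim_vec (0\<^sub>v n :: complex vec)"
      then have i: "i < n" by simp
      have "(?G *\<^sub>v c) $ i = (\<Sum>j<n. ?G $$ (i, j) * c $ j)"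
        using i by (intro mult_mat_vec_index_sum) (auto simp: c_def)
      also have "\<dots> = (\<Sum>j<n. \<Sum>k<m. e k ^ i * (coeff q j * e k ^ j))"
        using i by (simp add: c_def e(1) sum_distrib_left power_add mult_ac)
      also have "\<dots> = (\<Sum>k<m. e k ^ i * poly q (e k))"
        by (subst sum.swap) (simp add: pq sum_distrib_left)
      also have "\<dots> = 0"
        using root by simp
      finally show "(?G *\<^sub>v c) $ i = (0\<^sub>v n) $ i"
        using i by simp
    qed simp
    moreover have "c \<noteq> 0\<^sub>v n"
    proof
      assume "c = 0\<^sub>v n"
      then have "coeff q (degree q) = 0"
        using deg by (metis c_def index_vec index_zero_vec(1))
      with q0 show False by simp
    qed
    moreover have "c \<in> carrier_vec n"
      by (simp add: c_def)
    ultimately show False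
      using det det_0_iff_vec_prod_zero[of ?G n] by auto
  qed
  then obtain E where E: "E \<subseteq> ?E" "card E = n" "finite E"
    by (metis obtain_subset_with_card_n finite_imageI finite_lessThan finite_subset)
  then obtain \<mu> where \<mu>: "bij_betw \<mu> {..<n} E"
    using ex_bij_betw_nat_finite[OF E(3)] by (auto simp: lessThan_atLeast0)
  show thesis
  proof
    show "inj_on \<mu> {..<n}"
      using \<mu> by (rule bij_betw_imp_inj_on)
    show "eigenvalue N (\<mu> k)" if "k < n" for k
    proof -
      have "\<mu> k \<in> ?E"
        using \<mu> E(1) that by (auto simp: bij_betw_def)
      then show ?thesis using e(2) by auto
    qed
  qed
qed

section \<open>Diagonalizing a generic pencil\<close>

lemma sum_lessThan_double: "(\<Sum>i<2 * n. f i) = (\<Sum>k<n. f k + f (n + k))"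
  for f :: "nat \<Rightarrow> 'a :: comm_monoid_add"
proof -
  have "(\<Sum>i<n + p. f i) = (\<Sum>k<n. f k) + (\<Sum>k<p. f (n + k))" for p
    by (induction p) (simp_all add: add.assoc)
  from this[of n] show ?thesis
    by (simp add: mult_2 sum.distrib)
qed

lemma det_nonzero_inverse:
  fixes A :: "'a :: field mat"
  assumes A: "A \<in> carrier_mat m m" and det: "det A \<noteq> 0"
  obtains B where "B \<in> carrier_mat m m" "A * B = 1\<^sub>m m" "B * A = 1\<^sub>m m"
proof
  let ?B = "(1 / det A) \<cdot>\<^sub>m adj_mat A"
  show "?B \<in> carrier_mat m m"
    using adj_mat(1)[OF A] by simp
  show "A * ?B = 1\<^sub>m m" "?B * A = 1\<^sub>m m"
    using adj_mat[OF A] A det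
    by (auto simp: mult_smult_distrib[of A m m] mult_smult_assoc_mat[of _ m m] intro!: eq_matI)
qed

text \<open>Multiplying the eigenvector equation of adj(b) a by b turns it into det b (a v) = \<mu>
  (b v). Thus v lies in the kernel of the skew matrix a - (\<mu> / det b) b, which then has a second
  kernel vector. The coordinate k certifies independence of the pair.\<close>

lemma pencil_eigenvector_pair:
  assumes a: "a \<in> skew_mats m" and b: "b \<in> skew_mats m" and m: "even m"
    and d: "det b \<noteq> 0" and ev: "eigenvalue (adj_mat b * a) \<mu>"
  obtains v w k where "v \<in> carrier_vec m" "w \<in> carrier_vec m" "w \<noteq> 0\<^sub>v m"
    "k < m" "v $ k \<noteq> 0" "w $ k = 0"
    "a *\<^sub>v v = (\<mu> / det b) \<cdot>\<^sub>v (b *\<^sub>v v)" "a *\<^sub>v w = (\<mu> / det b) \<cdot>\<^sub>v (b *\<^sub>v w)"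
proof -
  let ?e = "\<mu> / det b"
  have ab: "a \<in> carrier_mat m m" "b \<in> carrier_mat m m"
    using a b by (auto simp: skew_mats_def)
  note adj = adj_mat[OF ab(2)]
  obtain v where v: "v \<in> carrier_vec m" "v \<noteq> 0\<^sub>v m" "(adj_mat b * a) *\<^sub>v v = \<mu> \<cdot>\<^sub>v v"
    using ev adj(1) by (auto simp: eigenvalue_def eigenvector_def)
  have "\<mu> \<cdot>\<^sub>v (b *\<^sub>v v) = b *\<^sub>v ((adj_mat b * a) *\<^sub>v v)"
    using v ab by (simp add: mult_mat_vec[of _ m m])
  also have "\<dots> = (b * (adj_mat b * a)) *\<^sub>v v"
    using v ab adj(1) by (intro assoc_mult_mat_vec[symmetric, of _ m m _ m]) auto
  also have "b * (adj_mat b * a) = det b \<cdot>\<^sub>m a"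
    using ab adj by (simp add: assoc_mult_mat[symmetric, of _ m m _ m _ m] mult_smult_assoc_mat[of _ m m])
  also have "(det b \<cdot>\<^sub>m a) *\<^sub>v v = det b \<cdot>\<^sub>v (a *\<^sub>v v)"
    using v ab by (intro eq_vecI) auto
  finally have "(1 / det b) \<cdot>\<^sub>v (\<mu> \<cdot>\<^sub>v (b *\<^sub>v v)) = (1 / det b) \<cdot>\<^sub>v (det b \<cdot>\<^sub>v (a *\<^sub>v v))"
    by simp
  then have av: "a *\<^sub>v v = ?e \<cdot>\<^sub>v (b *\<^sub>v v)"
    using d by (simp add: smult_smult_assoc)
  define C where "C = a + (- ?e) \<cdot>\<^sub>m b"
  have C: "C \<in> skew_mats m"
    unfolding C_def by (intro skew_mats_closed a b)
  have Cx: "C *\<^sub>v x = a *\<^sub>v x - ?e \<cdot>\<^sub>v (b *\<^sub>v x)" if "x \<in> carrier_vec m" for x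
    unfolding C_def using that ab
    by (intro eq_vecI) (auto simp: add_mult_distrib_mat_vec[of _ m m])
  obtain k where k: "k < m" "v $ k \<noteq> 0"
    using v by (metis eq_vecI carrier_vecD index_zero_vec)
  have "C *\<^sub>v v = 0\<^sub>v m"
    using ab v by (simp add: Cx av)
  then obtain w where w: "w \<in> carrier_vec m" "w \<noteq> 0\<^sub>v m" "C *\<^sub>v w = 0\<^sub>v m" "w $ k = 0"
    using skew_kernel_second[OF C m v(1) _ k] by blast
  have "a *\<^sub>v w = ?e \<cdot>\<^sub>v (b *\<^sub>v w)"
  proof (rule eq_vecI)
    fix i assume "i < dim_vec (?e \<cdot>\<^sub>v (b *\<^sub>v w))"
    then have i: "i < m" using ab by simp
    have "(a *\<^sub>v w - ?e \<cdot>\<^sub>v (b *\<^sub>v w)) $ i = 0"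
      using w(3) i by (simp add: Cx[OF w(1), symmetric])
    then show "(a *\<^sub>v w) $ i = (?e \<cdot>\<^sub>v (b *\<^sub>v w)) $ i"
      using i ab by (simp del: index_mult_mat_vec)
  qed (use ab in simp)
  with that v(1) w k av show thesis by blast
qed

text \<open>Two independent vectors in each of n eigenspaces are 2n independent vectors, because
  eigenvectors for distinct eigenvalues are independent; they form the columns of S.\<close>

lemma pencil_diagonalization:
  assumes a: "a \<in> skew_mats (2 * n)" and b: "b \<in> skew_mats (2 * n)"
    and d: "det b \<noteq> 0"
    and inj: "inj_on \<mu> {..<n}" and ev: "\<And>k. k < n \<Longrightarrow> eigenvalue (adj_mat b * a) (\<mu> k)"
  obtains S where "S \<in> carrier_mat (2 * n) (2 * n)" "det S \<noteq> 0"
    "a * S = b * S * mat_diag (2 * n) (\<lambda>i. \<mu> (i mod n) / det b)"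
proof -
  define m where "m = 2 * n"
  note a = a[folded m_def] and b = b[folded m_def]
  have ab: "a \<in> carrier_mat m m" "b \<in> carrier_mat m m"
    using a b by (auto simp: skew_mats_def)
  note adj = adj_mat[OF ab(2)]
  define N where "N = adj_mat b * a"
  have N: "N \<in> carrier_mat m m"
    using ab adj by (simp add: N_def)
  \<comment> \<open>Bundled into one predicate, the pair and its certifying coordinate can be chosen
    together as functions of k.\<close>
  define P where "P k v w r \<longleftrightarrow> v \<in> carrier_vec m \<and> w \<in> carrier_vec m \<and> w \<noteq> 0\<^sub>v m \<and> r < m \<and> v $ r \<noteq> 0 \<and> w $ r = 0 \<and>
      a *\<^sub>v v = (\<mu> k / det b) \<cdot>\<^sub>v (b *\<^sub>v v) \<and> a *\<^sub>v w = (\<mu> k / det b) \<cdot>\<^sub>v (b *\<^sub>v w)" for k v w r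
  have "\<exists>v w r. P k v w r" if "k < n" for k
    unfolding P_def using pencil_eigenvector_pair[OF a b _ d ev[OF that]] by (metis m_def dvd_triv_left)
  then obtain v w r where "\<And>k. k < n \<Longrightarrow> P k (v k) (w k) (r k)"
    by metis
  then have vw: "\<And>k. k < n \<Longrightarrow> v k \<in> carrier_vec m" "\<And>k. k < n \<Longrightarrow> w k \<in> carrier_vec m"
      "\<And>k. k < n \<Longrightarrow> w k \<noteq> 0\<^sub>v m"
    and r: "\<And>k. k < n \<Longrightarrow> r k < m" "\<And>k. k < n \<Longrightarrow> v k $ r k \<noteq> 0" "\<And>k. k < n \<Longrightarrow> w k $ r k = 0"
    and av: "\<And>k. k < n \<Longrightarrow> a *\<^sub>v v k = (\<mu> k / det b) \<cdot>\<^sub>v (b *\<^sub>v v k)"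
    and aw: "\<And>k. k < n \<Longrightarrow> a *\<^sub>v w k = (\<mu> k / det b) \<cdot>\<^sub>v (b *\<^sub>v w k)"
    by (simp_all add: P_def)
  have Nx: "N *\<^sub>v x = \<mu> k \<cdot>\<^sub>v x"
    if x: "x \<in> carrier_vec m" and ax: "a *\<^sub>v x = (\<mu> k / det b) \<cdot>\<^sub>v (b *\<^sub>v x)" for k x
  proof -
    have "N *\<^sub>v x = adj_mat b *\<^sub>v (a *\<^sub>v x)"
      unfolding N_def using x ab adj(1) by (intro assoc_mult_mat_vec[of _ m m _ m]) auto
    also have "\<dots> = (\<mu> k / det b) \<cdot>\<^sub>v (adj_mat b *\<^sub>v (b *\<^sub>v x))"
      unfolding ax using x ab adj(1) by (intro mult_mat_vec[of _ m m]) auto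
    also have "adj_mat b *\<^sub>v (b *\<^sub>v x) = (adj_mat b * b) *\<^sub>v x"
      using x ab adj(1) by (intro assoc_mult_mat_vec[symmetric, of _ m m _ m]) auto
    also have "\<dots> = det b \<cdot>\<^sub>v x"
      unfolding adj(3) using x by (intro eq_vecI) auto
    finally show ?thesis
      using d by (simp add: smult_smult_assoc)
  qed
  \<comment> \<open>All v come before all w, so columns i and i + n share the eigenvalue with index
    \<open>i mod n\<close>.\<close>
  define x where "x i = (if i < n then v i else w (i - n))" for i
  have x: "x i \<in> carrier_vec m" "a *\<^sub>v x i = (\<mu> (i mod n) / det b) \<cdot>\<^sub>v (b *\<^sub>v x i)" if "i < m" for i
  proof -
    have "i < n \<or> (\<exists>k<n. i = n + k)"
      using that by (metis m_def add_diff_inverse_nat mult_2 nat_add_left_cancel_less)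
    then show "x i \<in> carrier_vec m" "a *\<^sub>v x i = (\<mu> (i mod n) / det b) \<cdot>\<^sub>v (b *\<^sub>v x i)"
      by (auto simp: x_def vw av aw)
  qed
  define S where "S = mat m m (\<lambda>(r, i). x i $ r)"
  have S: "S \<in> carrier_mat m m"
    by (simp add: S_def)
  have "det S \<noteq> 0"
  proof
    assume "det S = 0"
    then obtain c where c: "c \<in> carrier_vec m" "c \<noteq> 0\<^sub>v m" "S *\<^sub>v c = 0\<^sub>v m"
      using det_0_iff_vec_prod_zero[OF S] by blast
    \<comment> \<open>The part of the vanishing combination that lies in the k-th
      eigenspace.\<close>
    define y where "y k s = c $ k * v k $ s + c $ (n + k) * w k $ s" for k s
    have Ny: "(\<Sum>s<m. N $$ (t, s) * y k s) = \<mu> k * y k t" if "k < n" "t < m" for k t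
    proof -
      have "(\<Sum>s<m. N $$ (t, s) * y k s) =
          c $ k * (\<Sum>s<m. N $$ (t, s) * v k $ s) + c $ (n + k) * (\<Sum>s<m. N $$ (t, s) * w k $ s)"
        by (simp add: y_def sum.distrib sum_distrib_left algebra_simps)
      also have "\<dots> = c $ k * ((N *\<^sub>v v k) $ t) + c $ (n + k) * ((N *\<^sub>v w k) $ t)"
        using that vw by (simp only: mult_mat_vec_index_sum[OF N])
      also have "\<dots> = \<mu> k * y k t"
        using that vw(1,2)[of k] by (simp add: Nx av aw y_def algebra_simps)
      finally show ?thesis .
    qed
    \<comment> \<open>Apply N repeatedly to the relation that the y_k sum to zero; each application
      multiplies y_k by \<open>\<mu> k\<close>. For a fixed coordinate t this is a Vandermonde
      system.\<close>
    have powers: "\<forall>t<m. (\<Sum>k<n. \<mu> k ^ j * y k t) = 0" for j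
    proof (induction j)
      case 0
      have "(\<Sum>k<n. y k t) = (S *\<^sub>v c) $ t" if "t < m" for t
      proof -
        have "(S *\<^sub>v c) $ t = (\<Sum>i<2 * n. x i $ t * c $ i)"
          unfolding mult_mat_vec_index_sum[OF S c(1) that] m_def[symmetric]
          using that by (intro sum.cong) (auto simp: S_def)
        also have "\<dots> = (\<Sum>k<n. y k t)"
          by (subst sum_lessThan_double) (simp add: x_def y_def mult.commute)
        finally show ?thesis ..
      qed
      with c(3) show ?case by simp
    next
      case (Suc j)
      show ?case
      proof (intro allI impI)
        fix t assume t: "t < m"
        have "(\<Sum>k<n. \<mu> k ^ Suc j * y k t) = (\<Sum>k<n. \<mu> k ^ j * (\<Sum>s<m. N $$ (t, s) * y k s))"
          using Ny t by (intro sum.cong) auto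
        also have "\<dots> = (\<Sum>s<m. N $$ (t, s) * (\<Sum>k<n. \<mu> k ^ j * y k s))"
          by (simp add: sum_distrib_left mult_ac) (rule sum.swap)
        also have "\<dots> = 0"
          using Suc by simp
        finally show "(\<Sum>k<n. \<mu> k ^ Suc j * y k t) = 0" .
      qed
    qed
    have y0: "y k t = 0" if "k < n" "t < m" for k t
      using that powers by (intro vandermonde_kernel_trivial[OF inj, of "\<lambda>k. y k t"]) auto
    \<comment> \<open>At the coordinate \<open>r k\<close> the vector w_k vanishes and v_k does not,
      which kills the coefficient of v_k; then any nonzero coordinate of w_k kills the other
      one.\<close>
    have ck: "c $ k = 0 \<and> c $ (n + k) = 0" if k: "k < n" for k
    proof
      show 1: "c $ k = 0"
        using y0[OF k r(1)[OF k]] r(2,3)[OF k] by (simp add: y_def)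
      obtain s where "s < m" "w k $ s \<noteq> 0"
        using vw(2,3)[OF k] by (metis eq_vecI carrier_vecD index_zero_vec)
      then show "c $ (n + k) = 0"
        using y0[OF k, of s] 1 by (simp add: y_def)
    qed
    have "c $ i = 0" if "i < m" for i
      using that ck[of i] ck[of "i - n"] by (cases "i < n") (auto simp: m_def)
    then have "c = 0\<^sub>v m"
      using c(1) by (intro eq_vecI) auto
    with c(2) show False ..
  qed
  moreover have "a * S = b * S * mat_diag m (\<lambda>i. \<mu> (i mod n) / det b)"
  proof (rule eq_matI)
    let ?L = "mat_diag m (\<lambda>i. \<mu> (i mod n) / det b)"
    fix t i assume "t < dim_row (b * S * ?L)" "i < dim_col (b * S * ?L)"
    then have ti: "t < m" "i < m"
      using ab by (auto simp: mat_diag_def)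
    have col: "col S i = x i"
      using ti x(1)[of i] by (intro eq_vecI) (auto simp: S_def)
    have "(a * S) $$ (t, i) = (a *\<^sub>v x i) $ t" "(b * S) $$ (t, i) = (b *\<^sub>v x i) $ t"
      using ti ab S by (simp_all add: col)
    moreover have "(b * S * ?L) $$ (t, i) = (b * S) $$ (t, i) * (\<mu> (i mod n) / det b)"
      using ti ab S by (subst mat_diag_mult_right[of _ m m]) auto
    ultimately show "(a * S) $$ (t, i) = (b * S * ?L) $$ (t, i)"
      using x(2)[OF ti(2)] ti ab by (simp del: index_mult_mat_vec index_mult_mat)
  qed (use ab S in \<open>auto simp: mat_diag_def\<close>)
  ultimately show thesis
    using that S by (simp add: m_def)
qed

section \<open>Equivalence of the congruence pencil with the normal form\<close>

text \<open>For skew Q one has Q X^T = -(X Q)^T, and transposing P Y P^T transposes just the middle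
  factor. The general diagonal \<open>l\<close> lets the lemma serve both a and b, the latter with
  the constant 1.\<close>

lemma congruence_rep_skew_part:
  assumes X: "X \<in> carrier_mat m m" and Q: "Q \<in> skew_mats m"
    and P: "P \<in> carrier_mat m m" and U: "U \<in> carrier_mat m m"
    and XQ: "X * Q = P * (U * mat_diag m l) * transpose_mat P"
  shows "congruence_rep X Q = P * skew_part m l U * transpose_mat P"
proof -
  define Y where "Y = U * mat_diag m l"
  have Y: "Y \<in> carrier_mat m m"
    using U by (simp add: Y_def)
  have Qc: "Q \<in> carrier_mat m m" "transpose_mat Q = - Q"
    using Q by (auto simp: skew_mats_def)
  have PT: "transpose_mat P \<in> carrier_mat m m" using P by simp
  have YT: "transpose_mat Y \<in> carrier_mat m m" using Y by simp
  have "Q * transpose_mat X = - (transpose_mat (X * Q))"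
    using X Qc by (simp add: transpose_mult[of X m m Q m])
  also have "transpose_mat (X * Q) = P * transpose_mat Y * transpose_mat P"
    unfolding XQ Y_def[symmetric]
    using P Y by (simp add: transpose_mult[of _ m m _ m] assoc_mult_mat[of _ m m _ m _ m])
  finally have "congruence_rep X Q = P * Y * transpose_mat P - P * transpose_mat Y * transpose_mat P"
    unfolding congruence_rep_def XQ Y_def[symmetric]
    using P Y by (simp add: minus_add_uminus_mat[of _ m m])
  also have "\<dots> = P * (Y - transpose_mat Y) * transpose_mat P"
    using P Y by (simp add: mult_minus_distrib_mat[of _ m m _ m] minus_mult_distrib_mat[of _ m m _ _ m])
  also have "Y - transpose_mat Y = skew_part m l U"
    unfolding Y_def mat_diag_mult_right[OF U]
    using U by (intro eq_matI) (auto simp: skew_part_def)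
  finally show ?thesis .
qed

lemma congruence_skew:
  assumes P: "P \<in> carrier_mat m m" and Q: "Q \<in> skew_mats m"
  shows "P * Q * transpose_mat P \<in> skew_mats m"
proof -
  have Qc: "Q \<in> carrier_mat m m" "transpose_mat Q = - Q"
    using Q by (auto simp: skew_mats_def)
  have "transpose_mat (P * Q * transpose_mat P) = P * transpose_mat Q * transpose_mat P"
    using P Qc(1) by (simp add: transpose_mult[of _ m m _ m] assoc_mult_mat[of _ m m _ m _ m])
  also have "\<dots> = - (P * Q * transpose_mat P)"
    unfolding Qc(2) using P Qc(1) by simp
  finally show ?thesis
    using P Qc(1) by (simp add: skew_mats_def)
qed

lemma linear_map_sandwich:
  fixes V :: "(complex, complex mat) module"
  assumes V: "vectorspace class_ring V" "carrier V \<subseteq> carrier_mat m m" "add V = (+)" "module.smult V = (\<cdot>\<^sub>m)"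
    and P: "P \<in> carrier_mat m m" and R: "R \<in> carrier_mat m m"
    and closed: "\<And>U. U \<in> carrier V \<Longrightarrow> P * U * R \<in> carrier V"
  shows "linear_map class_ring V V (\<lambda>U. P * U * R)"
proof (rule linear_mapI[OF V(1,1)])
  fix U U' c assume U: "U \<in> carrier V"
  then have Uc: "U \<in> carrier_mat m m" using V(2) by auto
  show "P * U * R \<in> carrier V" using closed U .
  show "P * (c \<odot>\<^bsub>V\<^esub> U) * R = c \<odot>\<^bsub>V\<^esub> (P * U * R)"
    by (simp only: V mult_smult_distrib[OF P Uc] mult_smult_assoc_mat[OF mult_carrier_mat[OF P Uc] R])
  assume "U' \<in> carrier V"
  then have "U' \<in> carrier_mat m m" using V(2) by auto
  then show "P * (U \<oplus>\<^bsub>V\<^esub> U') * R = P * U * R \<oplus>\<^bsub>V\<^esub> P * U' * R"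
    using P R Uc by (simp add: V mult_add_distrib_mat[of _ m m _ m] add_mult_distrib_mat[of _ m m _ _ m])
qed

lemma sandwich_inverse:
  fixes P :: "complex mat"
  assumes "P \<in> carrier_mat m m" "R \<in> carrier_mat m m" "P' \<in> carrier_mat m m" "R' \<in> carrier_mat m m"
    and U: "U \<in> carrier_mat m m" and "P' * P = 1\<^sub>m m" "R * R' = 1\<^sub>m m"
  shows "P' * (P * U * R) * R' = U"
proof -
  have "P' * (P * U * R) * R' = (P' * P) * U * (R * R')"
    using assms(1-5) by (simp add: assoc_mult_mat[of _ m m _ m _ m])
  then show ?thesis
    using assms by simp
qed

lemma has_algebraic_type_congruence_rep:
  assumes a: "a \<in> skew_mats (2 * n)" and b: "b \<in> skew_mats (2 * n)" and detb: "det b \<noteq> 0"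
    and \<mu>: "inj_on \<mu> {..<n}"
    and S: "S \<in> carrier_mat (2 * n) (2 * n)" "det S \<noteq> 0"
    and diag: "a * S = b * S * mat_diag (2 * n) (\<lambda>i. \<mu> (i mod n))"
  shows "has_algebraic_type (gl (2 * n)) (Lambda2 (2 * n))
    (\<lambda>X. congruence_rep X a) (\<lambda>X. congruence_rep X b)
    \<lparr>jordan_sizes = replicate_mset n {#1#},
     horizontal_indices = replicate_mset (3 * n) 1 + replicate_mset (2 * n * (n - 1)) 2,
     vertical_indices = {#}\<rparr>"
proof -
  define m where "m = 2 * n"
  let ?l = "\<lambda>i. \<mu> (i mod n)"
  note a = a[folded m_def] and b = b[folded m_def] and S = S[folded m_def] and diag = diag[folded m_def]
  have ab: "a \<in> carrier_mat m m" "b \<in> carrier_mat m m"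
    using a b by (auto simp: skew_mats_def)
  obtain b' where b': "b' \<in> carrier_mat m m" "b * b' = 1\<^sub>m m" "b' * b = 1\<^sub>m m"
    using det_nonzero_inverse[OF ab(2) detb] by blast
  obtain S' where S': "S' \<in> carrier_mat m m" "S * S' = 1\<^sub>m m" "S' * S = 1\<^sub>m m"
    using det_nonzero_inverse[OF S] by blast
  define P where "P = transpose_mat S'"
  define R where "R = S' * b'"
  define R' where "R' = b * S"
  have P: "P \<in> carrier_mat m m" "transpose_mat P = S'" and R: "R \<in> carrier_mat m m" "R' \<in> carrier_mat m m"
    and ST: "transpose_mat S \<in> carrier_mat m m"
    using S S' b' ab by (auto simp: P_def R_def R'_def)
  have PS: "transpose_mat S * P = 1\<^sub>m m" "P * transpose_mat S = 1\<^sub>m m"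
    unfolding P_def transpose_mult[OF S'(1) S(1), symmetric] transpose_mult[OF S(1) S'(1), symmetric] S'(2,3)
    by simp_all
  have RR: "R * R' = 1\<^sub>m m" "R' * R = 1\<^sub>m m"
  proof -
    have "R * R' = S' * (b' * b) * S"
      using S(1) S'(1) b'(1) ab by (simp add: R_def R'_def assoc_mult_mat[of _ m m _ m _ m])
    then show "R * R' = 1\<^sub>m m" unfolding b'(3) using S S' by simp
    have "R' * R = b * (S * S') * b'"
      using S(1) S'(1) b'(1) ab by (simp add: R_def R'_def assoc_mult_mat[of _ m m _ m _ m])
    then show "R' * R = 1\<^sub>m m" unfolding S'(2) using b' ab by simp
  qed
  \<comment> \<open>Both sides are S^(-1) b^(-1) a: solve a S = b S L for a and cancel b S.\<close>
  have Ra: "R * a = mat_diag m ?l * S'"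
  proof -
    define L where "L = mat_diag m ?l"
    have L: "L \<in> carrier_mat m m" "L * S' \<in> carrier_mat m m" "b * S \<in> carrier_mat m m"
      using S(1) ab S'(1) by (auto simp: L_def mat_diag_def)
    have "R * a = R * (a * S * S')"
      using ab S S' R by (simp add: assoc_mult_mat[of _ m m _ m _ m])
    also have "a * S * S' = b * S * (L * S')"
      unfolding diag L_def[symmetric] using assoc_mult_mat[OF L(3,1) S'(1)] .
    also have "R * (b * S * (L * S')) = R * R' * (L * S')"
      unfolding R'_def using assoc_mult_mat[OF R(1) L(3,2)] by simp
    finally show ?thesis
      unfolding RR left_mult_one_mat[OF L(2)] unfolding L_def .
  qed
  have Rb: "R * b = S'"
    using ab S' b' by (simp add: R_def assoc_mult_mat[of _ m m _ m _ m])
  \<comment> \<open>\<open>\<phi>\<close> substitutes X for U, and \<open>\<psi>\<close> is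
    congruence by \<open>P\<close>, whose transpose is \<open>S'\<close>.\<close>
  define \<phi> where "\<phi> U = P * U * R" for U
  define \<psi> where "\<psi> Q = P * Q * S'" for Q
  have "has_algebraic_type (gl m) (Lambda2 m) (skew_part m ?l) (skew_part m (\<lambda>_. 1))
      \<lparr>jordan_sizes = replicate_mset n {#1#},
       horizontal_indices = replicate_mset (3 * n) 1 + replicate_mset (2 * n * (n - 1)) 2,
       vertical_indices = {#}\<rparr>" (is "has_algebraic_type _ _ _ _ ?T")
    unfolding m_def by (rule has_algebraic_type_skew_part[OF \<mu>])
  then have "has_algebraic_type (gl m) (Lambda2 m) (\<lambda>X. congruence_rep X a) (\<lambda>X. congruence_rep X b) ?T"
  proof (rule has_algebraic_type_map[where \<phi> = \<phi> and \<psi> = \<psi>, rotated -1])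
    show "linear_map class_ring (gl m) (gl m) \<phi>"
      unfolding \<phi>_def by (rule linear_map_sandwich[OF matrix_vs _ _ _ P(1) R(1)]) (use P R in \<open>auto simp: module_mat_simps\<close>)
    show "bij_betw \<phi> (carrier (gl m)) (carrier (gl m))"
    proof (rule bij_betw_byWitness[where f' = "\<lambda>X. transpose_mat S * X * R'"])
      show "\<forall>U\<in>carrier (gl m). transpose_mat S * \<phi> U * R' = U"
        unfolding \<phi>_def module_mat_simps
        by (intro ballI sandwich_inverse[OF P(1) R(1) ST R(2) _ PS(1) RR(1)])
      show "\<forall>X\<in>carrier (gl m). \<phi> (transpose_mat S * X * R') = X"
        unfolding \<phi>_def module_mat_simps
        by (intro ballI sandwich_inverse[OF ST R(2) P(1) R(1) _ PS(2) RR(2)])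
      show "\<phi> ` carrier (gl m) \<subseteq> carrier (gl m)"
        "(\<lambda>X. transpose_mat S * X * R') ` carrier (gl m) \<subseteq> carrier (gl m)"
        using P(1) R ST by (auto simp: \<phi>_def module_mat_simps)
    qed
    show "linear_map class_ring (Lambda2 m) (Lambda2 m) \<psi>"
      unfolding \<psi>_def by (rule linear_map_sandwich[OF Lambda2_vectorspace _ _ _ P(1) S'(1)])
        (use congruence_skew[OF P(1)] in \<open>auto simp: P(2) skew_mats_def\<close>)
    have skew_carrier: "Q \<in> carrier_mat m m" if "Q \<in> skew_mats m" for Q
      using that by (simp add: skew_mats_def)
    show "bij_betw \<psi> (carrier (Lambda2 m)) (carrier (Lambda2 m))"
    proof (rule bij_betw_byWitness[where f' = "\<lambda>Q. transpose_mat S * Q * S"])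
      show "\<forall>Q\<in>carrier (Lambda2 m). transpose_mat S * \<psi> Q * S = Q"
        unfolding \<psi>_def Lambda2_simps
        by (intro ballI sandwich_inverse[OF P(1) S'(1) ST S(1) skew_carrier PS(1) S'(3)])
      show "\<forall>Q\<in>carrier (Lambda2 m). \<psi> (transpose_mat S * Q * S) = Q"
        unfolding \<psi>_def Lambda2_simps
        by (intro ballI sandwich_inverse[OF ST S(1) P(1) S'(1) skew_carrier PS(2) S'(2)])
      show "\<psi> ` carrier (Lambda2 m) \<subseteq> carrier (Lambda2 m)"
        using congruence_skew[OF P(1)] unfolding \<psi>_def Lambda2_simps P(2) by blast
      show "(\<lambda>Q. transpose_mat S * Q * S) ` carrier (Lambda2 m) \<subseteq> carrier (Lambda2 m)"
        using congruence_skew[OF ST] unfolding Lambda2_simps transpose_transpose by blast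
    qed
    fix U assume "U \<in> carrier (gl m)"
    then have U: "U \<in> carrier_mat m m" by (simp add: module_mat_simps)
    have \<phi>U: "\<phi> U \<in> carrier_mat m m" using P R U by (simp add: \<phi>_def)
    have "\<phi> U * a = P * U * (R * a)" "\<phi> U * b = P * U * (R * b)"
      using P R U ab by (simp_all add: \<phi>_def assoc_mult_mat[of _ m m _ m _ m])
    moreover have "P * U * (L * S') = P * (U * L) * S'" if "L \<in> carrier_mat m m" for L
      using that P(1) U S'(1) by (simp add: assoc_mult_mat[of _ m m _ m _ m])
    from this[OF mat_diag_dim] have "P * U * (mat_diag m l * S') = P * (U * mat_diag m l) * S'" for l .
    \<comment> \<open>An identity factor is inserted so that the map for b has the same shape as the
      one for a, with all diagonal entries 1.\<close>
    moreover have "S' = mat_diag m (\<lambda>_. 1) * S'"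
      using S'(1) by simp
    ultimately have "\<phi> U * a = P * (U * mat_diag m ?l) * transpose_mat P"
      "\<phi> U * b = P * (U * mat_diag m (\<lambda>_. 1)) * transpose_mat P"
      unfolding Ra Rb P(2) by metis+
    then show "congruence_rep (\<phi> U) a = \<psi> (skew_part m ?l U)"
      "congruence_rep (\<phi> U) b = \<psi> (skew_part m (\<lambda>_. 1) U)"
      using congruence_rep_skew_part[OF \<phi>U _ P(1) U] a b by (simp_all add: \<psi>_def P(2))
  qed
  then show ?thesis
    by (simp add: m_def)
qed

section \<open>Genericity\<close>

lemma poly_fun_sum:
  "(\<And>a. a \<in> A \<Longrightarrow> poly_fun X (f a)) \<Longrightarrow> poly_fun X (\<lambda>x. \<Sum>a\<in>A. f a x)"
proof (induction A rule: infinite_finite_induct)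
  case (insert a A)
  then show ?case
    using poly_fun.add[of X "f a" "\<lambda>x. \<Sum>a\<in>A. f a x"] by simp
qed (simp_all add: poly_fun.const)

lemma poly_fun_prod:
  "(\<And>a. a \<in> A \<Longrightarrow> poly_fun X (f a)) \<Longrightarrow> poly_fun X (\<lambda>x. \<Prod>a\<in>A. f a x)"
proof (induction A rule: infinite_finite_induct)
  case (insert a A)
  then show ?case
    using poly_fun.mult[of X "f a" "\<lambda>x. \<Prod>a\<in>A. f a x"] by simp
qed (simp_all add: poly_fun.const)

text \<open>The size is prescribed at every x, also outside \<open>carrier X\<close>:
  \<open>poly_fun\<close> speaks of functions on the whole type, so formulas for the entries of
  products and determinants have to hold everywhere.\<close>

definition poly_mat :: "(complex, 'a) module \<Rightarrow> nat \<Rightarrow> nat \<Rightarrow> ('a \<Rightarrow> complex mat) \<Rightarrow> bool" where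
  "poly_mat X r c F \<longleftrightarrow>
    (\<forall>x. F x \<in> carrier_mat r c) \<and> (\<forall>i<r. \<forall>j<c. poly_fun X (\<lambda>x. F x $$ (i, j)))"

lemma poly_mat_mat:
  "(\<And>i j. i < r \<Longrightarrow> j < c \<Longrightarrow> poly_fun X (\<lambda>x. f x i j)) \<Longrightarrow>
    poly_mat X r c (\<lambda>x. mat r c (\<lambda>(i, j). f x i j))"
  by (simp add: poly_mat_def)

lemma poly_mat_mult:
  assumes "poly_mat X r s F" "poly_mat X s c G"
  shows "poly_mat X r c (\<lambda>x. F x * G x)"
proof -
  have carr: "F x \<in> carrier_mat r s" "G x \<in> carrier_mat s c" for x
    using assms by (auto simp: poly_mat_def)
  have "(F x * G x) $$ (i, j) = (\<Sum>k<s. F x $$ (i, k) * G x $$ (k, j))" if "i < r" "j < c" for i j x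
    using carr[of x] that by (auto simp: scalar_prod_def lessThan_atLeast0)
  moreover have "poly_fun X (\<lambda>x. \<Sum>k<s. F x $$ (i, k) * G x $$ (k, j))" if "i < r" "j < c" for i j
    using assms that by (intro poly_fun_sum poly_fun.mult) (auto simp: poly_mat_def)
  moreover have "F x * G x \<in> carrier_mat r c" for x
    using carr[of x] by simp
  ultimately show ?thesis
    by (simp add: poly_mat_def)
qed

lemma poly_mat_pow:
  assumes "poly_mat X m m F"
  shows "poly_mat X m m (\<lambda>x. F x ^\<^sub>m k)"
proof (induction k)
  case 0
  have "dim_row (F x) = m" for x
    using assms by (auto simp: poly_mat_def)
  then show ?case
    by (simp add: poly_mat_def poly_fun.const)
next
  case (Suc k)
  then show ?case
    using poly_mat_mult[OF Suc assms] by simp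
qed

lemma poly_fun_trace_mat:
  assumes "poly_mat X m m F"
  shows "poly_fun X (\<lambda>x. trace_mat (F x))"
proof -
  have "dim_row (F x) = m" for x
    using assms by (auto simp: poly_mat_def)
  then show ?thesis
    using assms unfolding trace_mat_def by (auto intro!: poly_fun_sum simp: poly_mat_def)
qed

lemma poly_fun_det:
  assumes "poly_mat X m m F"
  shows "poly_fun X (\<lambda>x. det (F x))"
proof -
  have "det (F x) = (\<Sum>p\<in>{p. p permutes {0..<m}}. signof p * (\<Prod>i = 0..<m. F x $$ (i, p i)))" for x
    using assms by (intro det_def') (auto simp: poly_mat_def)
  moreover have "p i < m" if "p permutes {0..<m}" "i < m" for p i
    using permutes_in_image[OF that(1), of i] that(2) by simp
  ultimately show ?thesis
    using assms by (auto intro!: poly_fun_sum poly_fun.mult poly_fun.const poly_fun_prod simp: poly_mat_def)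
qed

lemma poly_mat_adj_mat:
  assumes "poly_mat X m m F"
  shows "poly_mat X m m (\<lambda>x. adj_mat (F x))"
proof -
  have carr: "F x \<in> carrier_mat m m" for x
    using assms by (auto simp: poly_mat_def)
  have "poly_mat X (m - 1) (m - 1) (\<lambda>x. mat_delete (F x) i j)" if "i < m" "j < m" for i j
    using assms carr that unfolding mat_delete_def
    by (auto simp: poly_mat_def carrier_matD[OF carr])
  then show ?thesis
    using carr unfolding adj_mat_def cofactor_def
    by (auto intro!: poly_mat_mat poly_fun.mult poly_fun.const poly_fun_det simp: carrier_matD[OF carr])
qed

lemma direct_sum_simps [simp]:
  "carrier (direct_sum V W) = carrier V \<times> carrier W"
  "x \<oplus>\<^bsub>direct_sum V W\<^esub> y = (fst x \<oplus>\<^bsub>V\<^esub> fst y, snd x \<oplus>\<^bsub>W\<^esub> snd y)"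
  "c \<odot>\<^bsub>direct_sum V W\<^esub> x = (c \<odot>\<^bsub>V\<^esub> fst x, c \<odot>\<^bsub>W\<^esub> snd x)"
  by (simp_all add: direct_sum_def case_prod_unfold)

text \<open>Rebuilding each component with \<open>mat m m\<close> enforces its size off the carrier
  and leaves it unchanged on the carrier.\<close>

lemma poly_mat_components:
  shows "poly_mat (direct_sum (Lambda2 m) (Lambda2 m)) m m (\<lambda>x. mat m m (\<lambda>(i, j). fst x $$ (i, j)))"
    and "poly_mat (direct_sum (Lambda2 m) (Lambda2 m)) m m (\<lambda>x. mat m m (\<lambda>(i, j). snd x $$ (i, j)))"
proof -
  let ?X = "direct_sum (Lambda2 m) (Lambda2 m)"
  have X: "vectorspace class_ring ?X"
    by (rule direct_sum_is_vs[OF Lambda2_vectorspace Lambda2_vectorspace])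
  have dim: "dim_row Q = m \<and> dim_col Q = m" if "Q \<in> skew_mats m" for Q
    using that by (auto simp: skew_mats_def)
  show "poly_mat ?X m m (\<lambda>x. mat m m (\<lambda>(i, j). fst x $$ (i, j)))"
    "poly_mat ?X m m (\<lambda>x. mat m m (\<lambda>(i, j). snd x $$ (i, j)))"
    by (intro poly_mat_mat poly_fun.linear linear_mapI[OF X scalar_module_vectorspace]; auto simp: dim)+
qed

section \<open>A pencil in the open set\<close>

text \<open>A kernel vector is the coefficient list of a polynomial q of degree below n. The
  Vandermonde lemma, applied to the numbers s q(\<mu>_k), makes q vanish at n distinct points, so q
  = 0. The factor s will be the common multiplicity of the eigenvalues.\<close>

lemma power_sum_det_nonzero:
  fixes \<mu> :: "nat \<Rightarrow> complex"
  assumes inj: "inj_on \<mu> {..<n}" and s: "s \<noteq> 0"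
  shows "det (mat n n (\<lambda>(i, j). s * (\<Sum>k<n. \<mu> k ^ (i + j)))) \<noteq> 0"
proof
  let ?G = "mat n n (\<lambda>(i, j). s * (\<Sum>k<n. \<mu> k ^ (i + j)))"
  assume "det ?G = 0"
  then obtain c where c: "c \<in> carrier_vec n" "c \<noteq> 0\<^sub>v n" "?G *\<^sub>v c = 0\<^sub>v n"
    using det_0_iff_vec_prod_zero[of ?G n] by auto
  define q where "q = (\<Sum>j<n. monom (c $ j) j)"
  have coeff_q: "coeff q j = (if j < n then c $ j else 0)" for j
    by (simp add: q_def coeff_sum)
  have poly_q: "poly q x = (\<Sum>j<n. c $ j * x ^ j)" for x
    by (simp add: q_def poly_sum poly_monom)
  have "(\<Sum>k<n. \<mu> k ^ i * (s * poly q (\<mu> k))) = 0" if "i < n" for i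
  proof -
    have "(\<Sum>k<n. \<mu> k ^ i * (s * poly q (\<mu> k))) = (\<Sum>k<n. \<Sum>j<n. s * \<mu> k ^ (i + j) * c $ j)"
      by (simp add: poly_q sum_distrib_left power_add mult_ac)
    also have "\<dots> = (\<Sum>j<n. ?G $$ (i, j) * c $ j)"
      using that by (subst sum.swap) (simp add: sum_distrib_left sum_distrib_right)
    also have "\<dots> = (?G *\<^sub>v c) $ i"
      using that c(1) by (intro mult_mat_vec_index_sum[symmetric]) auto
    finally show ?thesis
      using that c(3) by simp
  qed
  note vandermonde_kernel_trivial[OF inj this]
  then have root: "poly q (\<mu> k) = 0" if "k < n" for k
    using s that by (metis mult_eq_0_iff)
  obtain j where j: "j < n" "c $ j \<noteq> 0"
    using c by (metis eq_vecI carrier_vecD index_zero_vec)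
  then have "q \<noteq> 0"
    using coeff_q by (metis coeff_0)
  then have "coeff q (degree q) \<noteq> 0"
    by simp
  then have "degree q < n"
    using coeff_q by metis
  moreover have "card (\<mu> ` {..<n}) = n"
    using inj by (simp add: card_image)
  ultimately have "q = 0"
    using root by (intro poly_eqI_degree[of "\<mu> ` {..<n}"]) auto
  with \<open>q \<noteq> 0\<close> show False ..
qed

definition power_sum_mat :: "nat \<Rightarrow> complex mat \<Rightarrow> complex mat" where
  "power_sum_mat n N = mat n n (\<lambda>(i, j). trace_mat (N ^\<^sub>m (i + j)))"

lemma mat_diag_pow: "mat_diag m f ^\<^sub>m k = mat_diag m (\<lambda>i. f i ^ k)"
proof (induction k)
  case 0
  have "dim_row (mat_diag m f) = m"
    by (simp add: mat_diag_def)
  then show ?case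
    by (auto simp: mat_diag_def intro!: eq_matI)
next
  case (Suc k)
  then show ?case
    by (simp only: pow_mat.simps mat_diag_diag power_Suc2)
qed

text \<open>Take b to be the standard symplectic matrix and a = b diag(0, ..., n - 1, 0, ..., n -
  1). The nonzero entries of b join i with i + n, where the diagonal factors agree, so a is again
  skew.\<close>

lemma generic_pencil_exists:
  assumes "n \<ge> 1"
  obtains a b where "a \<in> skew_mats (2 * n)" "b \<in> skew_mats (2 * n)" "det b \<noteq> 0"
    "det (power_sum_mat n (adj_mat b * a)) \<noteq> 0"
proof -
  define m where "m = 2 * n"
  define f where "f i j = (if j = i + n then 1 else if i = j + n then - 1 else 0 :: complex)" for i j
  define l where "l i = (of_nat (i mod n) :: complex)" for i
  define b where "b = mat m m (\<lambda>(i, j). f i j)"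
  define a where "a = b * mat_diag m l"
  have b: "b \<in> carrier_mat m m"
    by (simp add: b_def)
  have a_mat: "a = mat m m (\<lambda>(i, j). f i j * l j)"
    unfolding a_def mat_diag_mult_right[OF b] by (rule eq_matI) (auto simp: b_def)
  have "b \<in> skew_mats m"
    using assms by (auto simp: skew_mats_def b_def f_def intro!: eq_matI)
  moreover have "a \<in> skew_mats m"
    using assms unfolding a_mat by (auto simp: skew_mats_def f_def l_def intro!: eq_matI)
  moreover have d: "det b \<noteq> 0"
  proof
    assume "det b = 0"
    then obtain v where v: "v \<in> carrier_vec m" "v \<noteq> 0\<^sub>v m" "b *\<^sub>v v = 0\<^sub>v m"
      using det_0_iff_vec_prod_zero[OF b] by blast
    have *: "(\<Sum>j<m. f i j * v $ j) = 0" if "i < m" for i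
    proof -
      have "(\<Sum>j<m. f i j * v $ j) = (\<Sum>j<m. b $$ (i, j) * v $ j)"
        using that by (simp add: b_def)
      then show ?thesis
        using mult_mat_vec_index_sum[OF b v(1) that] v(3) that by simp
    qed
    \<comment> \<open>Each row of b has one nonzero entry: row j + n or row j - n contains only the
      coordinate j.\<close>
    have "v $ j = 0" if "j < m" for j
    proof (cases "j < n")
      case True
      have "(\<Sum>i<m. f (j + n) i * v $ i) = (\<Sum>i<m. if i = j then - v $ j else 0)"
        using assms by (intro sum.cong) (auto simp: f_def m_def)
      then show ?thesis
        using *[of "j + n"] True by (simp add: m_def)
    next
      case False
      have "(\<Sum>i<m. f (j - n) i * v $ i) = (\<Sum>i<m. if i = j then v $ j else 0)"
        using assms False that by (intro sum.cong) (auto simp: f_def m_def)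
      then show ?thesis
        using *[of "j - n"] False that by (simp add: m_def)
    qed
    then have "v = 0\<^sub>v m"
      using v(1) by (intro eq_vecI) auto
    with v(2) show False ..
  qed
  moreover have "det (power_sum_mat n (adj_mat b * a)) \<noteq> 0"
  proof -
    note adj = adj_mat[OF b]
    have "adj_mat b * a = det b \<cdot>\<^sub>m 1\<^sub>m m * mat_diag m l"
      unfolding a_def adj(3)[symmetric] using assoc_mult_mat[OF adj(1) b mat_diag_dim] by simp
    also have "\<dots> = mat_diag m (\<lambda>i. det b * l i)"
      by (subst mat_diag_mult_right[of _ m m]) (auto simp: mat_diag_def intro!: eq_matI)
    finally have N: "adj_mat b * a = mat_diag m (\<lambda>i. det b * l i)" .
    \<comment> \<open>The factor 2 appears because i and i + n carry the same diagonal
      value.\<close>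
    have "trace_mat (mat_diag m (\<lambda>i. (det b * l i) ^ k)) = 2 * (\<Sum>i<n. (det b * of_nat i) ^ k)" for k
    proof -
      have "trace_mat (mat_diag m (\<lambda>i. (det b * l i) ^ k)) = (\<Sum>i<2 * n. (det b * l i) ^ k)"
        by (simp add: trace_mat_def mat_diag_def m_def)
      also have "\<dots> = 2 * (\<Sum>i<n. (det b * of_nat i) ^ k)"
        by (subst sum_lessThan_double) (simp add: l_def sum_distrib_left)
      finally show ?thesis .
    qed
    then have "power_sum_mat n (adj_mat b * a) =
        mat n n (\<lambda>(i, j). 2 * (\<Sum>k<n. (det b * of_nat k) ^ (i + j)))"
      by (simp add: power_sum_mat_def N mat_diag_pow)
    moreover have "inj_on (\<lambda>k. det b * of_nat k) {..<n}"
      using d by (auto simp: inj_on_def)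
    ultimately show ?thesis
      using power_sum_det_nonzero[of "\<lambda>k. det b * of_nat k" n 2] by simp
  qed
  ultimately show thesis
    using that by (simp add: m_def)
qed

theorem theorem4p14:
  fixes n :: nat
  assumes "n \<ge> 1"
  shows "let H = replicate_mset (3 * n) 1 + replicate_mset (2 * n * (n - 1)) 2 in
    size H = n * (2 * n + 1) \<and>
    has_JK_invariants (gl (2 * n)) (Lambda2 (2 * n)) congruence_rep
      \<lparr>jordan_sizes = replicate_mset n {#1#},
       horizontal_indices = H,
       vertical_indices = {#}\<rparr>"
proof -
  let ?H = "replicate_mset (3 * n) 1 + replicate_mset (2 * n * (n - 1)) 2 :: nat multiset"
  let ?T = "\<lparr>jordan_sizes = replicate_mset n {#1#}, horizontal_indices = ?H, vertical_indices = {#}\<rparr>"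
  define m where "m = 2 * n"
  define X where "X = direct_sum (Lambda2 m) (Lambda2 m)"
  define F G where "F x = mat m m (\<lambda>(i, j). fst x $$ (i, j))"
    and "G x = mat m m (\<lambda>(i, j). snd x $$ (i, j))" for x :: "complex mat \<times> complex mat"
  \<comment> \<open>The product is nonzero exactly when b is invertible and the power sum matrix of
    N is nonsingular, so a single polynomial describes the open set.\<close>
  define p where "p x = det (G x) * det (power_sum_mat n (adj_mat (G x) * F x))" for x
  have FG: "F (a, b) = a" "G (a, b) = b" if "a \<in> skew_mats m" "b \<in> skew_mats m" for a b
    using that by (auto simp: F_def G_def skew_mats_def intro!: eq_matI)
  have "poly_mat X m m F" "poly_mat X m m G"
    unfolding X_def F_def G_def by (rule poly_mat_components)+
  note FG_poly = this
  have "poly_mat X m m (\<lambda>x. (adj_mat (G x) * F x) ^\<^sub>m k)" for k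
    by (intro poly_mat_pow poly_mat_mult[OF poly_mat_adj_mat] FG_poly)
  then have "poly_fun X (\<lambda>x. trace_mat ((adj_mat (G x) * F x) ^\<^sub>m k))" for k
    by (rule poly_fun_trace_mat)
  then have "poly_mat X n n (\<lambda>x. power_sum_mat n (adj_mat (G x) * F x))"
    unfolding power_sum_mat_def by (rule poly_mat_mat)
  then have p: "poly_fun X p"
    unfolding p_def by (intro poly_fun.mult poly_fun_det[OF FG_poly(2)] poly_fun_det)
  define S where "S = {x \<in> carrier X. p x \<noteq> 0}"
  have "zariski_open X S"
    unfolding zariski_open_def zariski_closed_def S_def
    using p by (intro conjI exI[of _ "{p}"]) auto
  moreover have "S \<noteq> {}"
  proof -
    obtain a b where "a \<in> skew_mats m" "b \<in> skew_mats m" "det b \<noteq> 0"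
        "det (power_sum_mat n (adj_mat b * a)) \<noteq> 0"
      using generic_pencil_exists[OF assms] unfolding m_def by blast
    then have "(a, b) \<in> S"
      by (simp add: S_def X_def p_def FG)
    then show ?thesis by blast
  qed
  moreover have "has_algebraic_type (gl m) (Lambda2 m) (\<lambda>\<xi>. congruence_rep \<xi> a) (\<lambda>\<xi>. congruence_rep \<xi> b) ?T"
    if "(a, b) \<in> S" for a b
  proof -
    have ab: "a \<in> skew_mats m" "b \<in> skew_mats m"
      using that by (auto simp: S_def X_def)
    then have d: "det b \<noteq> 0" and G: "det (power_sum_mat n (adj_mat b * a)) \<noteq> 0"
      using that by (auto simp: S_def p_def FG)
    have "adj_mat b * a \<in> carrier_mat m m"
      using ab adj_mat(1)[of b m] by (auto simp: skew_mats_def)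
    then obtain \<mu> where \<mu>: "inj_on \<mu> {..<n}" "\<And>k. k < n \<Longrightarrow> eigenvalue (adj_mat b * a) (\<mu> k)"
      using power_sum_det_distinct_eigenvalues G unfolding power_sum_mat_def by blast
    obtain T where T: "T \<in> carrier_mat m m" "det T \<noteq> 0"
        "a * T = b * T * mat_diag m (\<lambda>i. \<mu> (i mod n) / det b)"
      using pencil_diagonalization[of a n b \<mu>] ab d \<mu> unfolding m_def by blast
    \<comment> \<open>Division by det b passes from the eigenvalues of N to those of the pencil and
      keeps them distinct.\<close>
    have "inj_on (\<lambda>k. \<mu> k / det b) {..<n}"
      using \<mu>(1) d by (auto simp: inj_on_def)
    then show ?thesis
      using has_algebraic_type_congruence_rep[of a n b "\<lambda>k. \<mu> k / det b" T] ab d T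
      unfolding m_def by blast
  qed
  ultimately have "has_JK_invariants (gl m) (Lambda2 m) congruence_rep ?T"
    unfolding has_JK_invariants_def X_def by blast
  moreover have "size ?H = n * (2 * n + 1)"
    using assms by (cases n) (auto simp: algebra_simps)
  ultimately show ?thesis
    by (simp add: Let_def m_def)
qed

end
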